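(* Let $\mathcal{X}$ be a completely regular topological space and let $\Theta$ be an Abelian group of continuous transformations acting on $\mathcal{X}$. Let $\mathsf{G}$ be a $\Theta$-invariant vector space of real-valued functions on $\mathcal{X}$ which contains the constants and is such that for all $\mathsf{g}_1,\mathsf{g}_2\in\mathsf{G}$ there exists $\mathsf{g}\in\mathsf{G}$ with $\mathsf{g}_1\vee\mathsf{g}_2\le\mathsf{g}$. Let $\chi$ be a regularity modulus on $\mathcal{X}$ (with respect to $\mathsf{G}$), and assume that $\mathsf{G}$ consists of $\chi$-regular functions. Furthermore, assume that at least one of the following conditions holds: (i) $\mathsf{G}$ consists of continuous functions and $\chi$ is pointwisely approximated from below by a monotone sequence of functions $\mathsf{g}_n\in\mathsf{G}$, $n\ge1$; (ii) $\chi$ is $\Theta$-invariant. Let $\Phi$ be a $\Theta$-invariant linear functional on $\mathsf{G}$ with $\Phi(1)=1$. Then, for every given $r\ge0$, there exists a $\Theta$-stationary random element $\xi$ in $\mathcal{X}$ satisfying $$\mathbf{E}\,\mathsf{g}(\xi)=\Phi(\mathsf{g})\ \text{ for all } \mathsf{g}\in\mathsf{G},\qquad \mathbf{E}\,\chi(\xi)\le r,$$ if and only if $$\sup_{\mathsf{g}\in\mathsf{G},\ \mathsf{g}\le\chi}\Phi(\mathsf{g})\le r.$$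
   Context: Completely regular means that each closed set and each singleton disjoint from it can be separated by a continuous function. For a function $\mathsf{v}$ on $\mathcal{X}$ and $\theta\in\Theta$ put $(\theta\mathsf{v})(X)=\mathsf{v}(\theta X)$, $X\in\mathcal{X}$. The space $\mathsf{G}$ is $\Theta$-invariant if $\theta\mathsf{g}\in\mathsf{G}$ for all $\mathsf{g}\in\mathsf{G}$, $\theta\in\Theta$; the function $\chi$ is $\Theta$-invariant if $\theta\chi=\chi$ for all $\theta\in\Theta$; a functional $\Phi$ is $\Theta$-invariant if, for each $\theta\in\Theta$ and each $\mathsf{v}$ in its domain of definition, $\Phi(\theta\mathsf{v})$ is defined and equal to $\Phi(\mathsf{v})$. A Borel random element $\xi$ in $\mathcal{X}$ is $\Theta$-stationary if, for each $\theta\in\Theta$, $\theta\xi$ has the same distribution as $\xi$. Given a vector space $\mathsf{G}$ of functions on $\mathcal{X}$, a regularity modulus on $\mathcal{X}$ is a lower semi-continuous function $\chi:\mathcal{X}\to[0,\infty]$ such that, for each $\mathsf{g}\in\mathsf{G}$, the set $\mathcal{H}_{\mathsf{g}}=\{X\in\mathcal{X}:\chi(X)\le\mathsf{g}(X)\}$ is relatively compact. A measurable function $\mathsf{v}:\mathcal{X}\to\mathbb{R}$ is $\chi$-regular if $\mathsf{v}$ is continuous on $\mathcal{H}_{\mathsf{g}}$ for each $\mathsf{g}\in\mathsf{G}$.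
   Formalization: In the definition of χ-regular, "continuous on H_g" is replaced by "continuous on the closure of H_g" for each g in G; with H_g itself the claim fails under (ii), and for continuous G the two agree. *)

theory Defs
  imports "HOL-Probability.Probability" "HOL-Algebra.Bij"
begin

section \<open>Spaces of functions and transformations\<close>

definition function_space :: "('x \<Rightarrow> real) set \<Rightarrow> bool" where
  "function_space G \<longleftrightarrow>
     (\<lambda>x. 0) \<in> G \<and>
     (\<forall>g\<in>G. \<forall>h\<in>G. (\<lambda>x. g x + h x) \<in> G) \<and>
     (\<forall>c. \<forall>g\<in>G. (\<lambda>x. c * g x) \<in> G)"

definition linear_functional_on :: "('x \<Rightarrow> real) set \<Rightarrow> (('x \<Rightarrow> real) \<Rightarrow> real) \<Rightarrow> bool" where
  "linear_functional_on G \<Phi> \<longleftrightarrow>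
     (\<forall>g\<in>G. \<forall>h\<in>G. \<Phi> (\<lambda>x. g x + h x) = \<Phi> g + \<Phi> h) \<and>
     (\<forall>c. \<forall>g\<in>G. \<Phi> (\<lambda>x. c * g x) = c * \<Phi> g)"

definition abelian_transformation_group :: "('x::topological_space \<Rightarrow> 'x) set \<Rightarrow> bool" where
  "abelian_transformation_group \<Theta> \<longleftrightarrow>
     subgroup \<Theta> (BijGroup UNIV) \<and>
     comm_group ((BijGroup UNIV)\<lparr>carrier := \<Theta>\<rparr>) \<and>
     (\<forall>\<theta>\<in>\<Theta>. continuous_on UNIV \<theta>)"

definition invariant_function :: "('x \<Rightarrow> 'x) set \<Rightarrow> ('x \<Rightarrow> 'b) \<Rightarrow> bool" where
  "invariant_function \<Theta> v \<longleftrightarrow> (\<forall>\<theta>\<in>\<Theta>. v \<circ> \<theta> = v)"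

definition invariant_space :: "('x \<Rightarrow> 'x) set \<Rightarrow> ('x \<Rightarrow> real) set \<Rightarrow> bool" where
  "invariant_space \<Theta> G \<longleftrightarrow> (\<forall>\<theta>\<in>\<Theta>. \<forall>g\<in>G. g \<circ> \<theta> \<in> G)"

text \<open>Only the values of \<open>\<Phi>\<close> on its domain of definition \<open>G\<close> are meaningful.\<close>

definition invariant_functional ::
  "('x \<Rightarrow> 'x) set \<Rightarrow> ('x \<Rightarrow> real) set \<Rightarrow> (('x \<Rightarrow> real) \<Rightarrow> real) \<Rightarrow> bool" where
  "invariant_functional \<Theta> G \<Phi> \<longleftrightarrow> (\<forall>\<theta>\<in>\<Theta>. \<forall>g\<in>G. g \<circ> \<theta> \<in> G \<and> \<Phi> (g \<circ> \<theta>) = \<Phi> g)"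

section \<open>Regularity moduli\<close>

text \<open>
  Values of \<open>chi\<close> and of real functions are compared in the extended reals: the embedding
  \<open>ennreal\<close> truncates negative reals to 0, which would put every point with \<open>chi x = 0\<close>
  and \<open>g x < 0\<close> into the sublevel set.
\<close>

definition sublevel :: "('x \<Rightarrow> ennreal) \<Rightarrow> ('x \<Rightarrow> real) \<Rightarrow> 'x set" where
  "sublevel chi g = {x. enn2ereal (chi x) \<le> ereal (g x)}"

definition lower_semicontinuous :: "('x::topological_space \<Rightarrow> ennreal) \<Rightarrow> bool" where
  "lower_semicontinuous chi \<longleftrightarrow> (\<forall>a. open {x. a < chi x})"

definition regularity_modulus ::
  "('x::topological_space \<Rightarrow> real) set \<Rightarrow> ('x \<Rightarrow> ennreal) \<Rightarrow> bool" where
  "regularity_modulus G chi \<longleftrightarrow>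
     lower_semicontinuous chi \<and> (\<forall>g\<in>G. compact (closure (sublevel chi g)))"

text \<open>
  Continuity on the relatively compact set \<open>sublevel chi g\<close> is understood up to its closure:
  \<open>v\<close> converges to \<open>v x\<close> along every net of the sublevel set that converges to a point \<open>x\<close> of
  the space. If \<open>G\<close> consists of continuous functions, the sublevel sets are closed and the
  closure can be dropped. In general it is needed for the characterisation of realisable
  functionals. Without it, take the space [0,1], the trivial group, \<open>chi x = 1/x\<close> with
  \<open>chi 0 = \<infinity>\<close>, and \<open>G\<close> spanned by 1, by the identity \<open>h\<close> and by \<open>g x = 1/x\<close> with \<open>g 0 = 0\<close>. All of
  \<open>G\<close> is continuous on \<open>{0<..1}\<close>, which contains every sublevel set. The functional with values
  1, 1, 2 at 1, \<open>h\<close>, \<open>g\<close> is the limit of the expectations under the laws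
  \<open>(1 - 1/n) \<delta>\<^sub>1 + (1/n) \<delta>\<close> with the second point mass at \<open>1/n\<close>; as \<open>chi\<close> has expectation at most
  2 under them, the functional is at most 2 on all elements of \<open>G\<close> below \<open>chi\<close>. But expectation 1
  of \<open>h\<close> forces the point mass at 1, under which \<open>g\<close> has expectation 1 and not 2.
\<close>

definition chi_regular ::
  "('x::topological_space \<Rightarrow> real) set \<Rightarrow> ('x \<Rightarrow> ennreal) \<Rightarrow> ('x \<Rightarrow> real) \<Rightarrow> bool" where
  "chi_regular G chi v \<longleftrightarrow>
     v \<in> borel_measurable borel \<and> (\<forall>g\<in>G. continuous_on (closure (sublevel chi g)) v)"

definition approximated_from_below :: "('x \<Rightarrow> real) set \<Rightarrow> ('x \<Rightarrow> ennreal) \<Rightarrow> bool" where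
  "approximated_from_below G chi \<longleftrightarrow>
     (\<exists>gs :: nat \<Rightarrow> 'x \<Rightarrow> real.
        (\<forall>n. gs n \<in> G) \<and>
        (\<forall>x. incseq (\<lambda>n. gs n x) \<and> (\<lambda>n. ereal (gs n x)) \<longlonglongrightarrow> enn2ereal (chi x)))"

section \<open>Stationary random elements\<close>

definition stationary_element ::
  "('x::topological_space \<Rightarrow> 'x) set \<Rightarrow> 'w measure \<Rightarrow> ('w \<Rightarrow> 'x) \<Rightarrow> bool" where
  "stationary_element \<Theta> M \<xi> \<longleftrightarrow>
     prob_space M \<and> \<xi> \<in> measurable M borel \<and>
     (\<forall>\<theta>\<in>\<Theta>. distr M borel (\<lambda>\<omega>. \<theta> (\<xi> \<omega>)) = distr M borel \<xi>)"

definition realises ::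
  "('x::topological_space \<Rightarrow> real) set \<Rightarrow> ('x \<Rightarrow> ennreal) \<Rightarrow> (('x \<Rightarrow> real) \<Rightarrow> real) \<Rightarrow> real
     \<Rightarrow> 'w measure \<Rightarrow> ('w \<Rightarrow> 'x) \<Rightarrow> bool" where
  "realises G chi \<Phi> r M \<xi> \<longleftrightarrow>
     (\<forall>g\<in>G. integrable M (\<lambda>\<omega>. g (\<xi> \<omega>)) \<and> (\<integral>\<omega>. g (\<xi> \<omega>) \<partial>M) = \<Phi> g) \<and>
     (\<integral>\<^sup>+\<omega>. chi (\<xi> \<omega>) \<partial>M) \<le> ennreal r"

definition minorant_sup ::
  "('x \<Rightarrow> real) set \<Rightarrow> ('x \<Rightarrow> ennreal) \<Rightarrow> (('x \<Rightarrow> real) \<Rightarrow> real) \<Rightarrow> ereal" where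
  "minorant_sup G chi \<Phi> = (SUP g\<in>{g\<in>G. \<forall>x. ereal (g x) \<le> enn2ereal (chi x)}. ereal (\<Phi> g))"

end

theory Submission
  imports Defs
begin

text \<open>
  Integration of \<open>g \<le> chi\<close> shows that the bound on the minorants is necessary. For sufficiency one
  first extends \<open>\<Phi>\<close> to an invariant positive functional \<open>L\<close> on all functions dominated by elements
  of \<open>G\<close>, in particular to all bounded continuous functions, such that \<open>L v \<le> e * r\<close> whenever
  \<open>v \<le> e * chi\<close>. The bound on the minorants makes these requirements consistent, and the extension
  is a Hahn--Banach argument (\<open>dominating_cone_invariant_functional\<close>). It yields an invariant
  functional as soon as the requirements themselves are invariant, since the transformations
  commute: averages over long pieces of orbits make coboundaries small.

  As the sublevel sets of \<open>chi\<close> are relatively compact, \<open>L\<close> is tight on the bounded continuous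
  functions. In a completely regular space it is then represented by a Borel probability measure,
  which is built from its values on open sets by Caratheodory's construction (locale
  \<open>tight_functional\<close>). These values are determined by \<open>L\<close>, so the measure is invariant. Its
  integrals of lower semicontinuous functions are controlled by \<open>L\<close> as well
  (\<open>nn_integral_riesz_measure_le\<close>), hence \<open>chi\<close> has integral at most \<open>r\<close>. A function in \<open>G\<close> differs from
  a bounded continuous function by at most \<open>e * chi\<close>, with \<open>e\<close> as small as desired
  (\<open>regular_approximation\<close>), therefore its integral is \<open>L g = \<Phi> g\<close>.

  It remains to make the requirements invariant: one needs an invariant stock of functions with
  prescribed bounds for their integrals that contains \<open>chi\<close> with the bound \<open>r\<close>. If \<open>chi\<close> is
  invariant, its multiples suffice (\<open>realisation_with_invariant_modulus\<close>). If \<open>chi\<close> is the limit of an increasing sequence in \<open>G\<close>, take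
  first a measure that realises \<open>\<Phi>\<close> but need not be invariant. Under it all translates of \<open>chi\<close> have
  integral at most \<open>r\<close>, by monotone convergence and invariance of \<open>\<Phi>\<close>. So the functions all of
  whose translates have integral at most \<open>a\<close> under this measure form, for varying \<open>a\<close>, a suitable
  stock, and the extension argument applies a second time with this stock.
\<close>

section \<open>Function spaces and linear functionals\<close>

lemma function_space_zero: "function_space F \<Longrightarrow> (\<lambda>x. 0) \<in> F"
  by (simp add: function_space_def)

lemma function_space_add: "function_space F \<Longrightarrow> v \<in> F \<Longrightarrow> w \<in> F \<Longrightarrow> (\<lambda>x. v x + w x) \<in> F"
  by (simp add: function_space_def)

lemma function_space_scale: "function_space F \<Longrightarrow> v \<in> F \<Longrightarrow> (\<lambda>x. c * v x) \<in> F"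
  by (simp add: function_space_def)

lemma function_space_minus: "function_space F \<Longrightarrow> v \<in> F \<Longrightarrow> (\<lambda>x. - v x) \<in> F"
  using function_space_scale[of F v "-1"] by simp

lemma function_space_diff:
  "function_space F \<Longrightarrow> v \<in> F \<Longrightarrow> w \<in> F \<Longrightarrow> (\<lambda>x. v x - w x) \<in> F"
  using function_space_add[of F v "\<lambda>x. - w x"] function_space_minus by force

lemma function_space_sum:
  assumes "function_space F" "\<And>i. i \<in> I \<Longrightarrow> v i \<in> F"
  shows "(\<lambda>x. \<Sum>i\<in>I. v i x) \<in> F"
  using assms(2)
proof (induction I rule: infinite_finite_induct)
  case (insert i I)
  then show ?case using function_space_add[OF assms(1), of "v i"] by simp
qed (auto intro: function_space_zero[OF assms(1)])

lemma linear_functional_on_add: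
  "linear_functional_on F L \<Longrightarrow> v \<in> F \<Longrightarrow> w \<in> F \<Longrightarrow> L (\<lambda>x. v x + w x) = L v + L w"
  by (simp add: linear_functional_on_def)

lemma linear_functional_on_scale:
  "linear_functional_on F L \<Longrightarrow> v \<in> F \<Longrightarrow> L (\<lambda>x. c * v x) = c * L v"
  by (simp add: linear_functional_on_def)

lemma linear_functional_on_zero:
  "linear_functional_on F L \<Longrightarrow> function_space F \<Longrightarrow> L (\<lambda>x. 0) = 0"
  using linear_functional_on_scale[of F L "\<lambda>x. 0" 0] function_space_zero[of F] by simp

lemma linear_functional_on_minus:
  "linear_functional_on F L \<Longrightarrow> v \<in> F \<Longrightarrow> L (\<lambda>x. - v x) = - L v"
  using linear_functional_on_scale[of F L v "-1"] by simp

lemma linear_functional_on_diff: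
  "linear_functional_on F L \<Longrightarrow> function_space F \<Longrightarrow> v \<in> F \<Longrightarrow> w \<in> F
    \<Longrightarrow> L (\<lambda>x. v x - w x) = L v - L w"
  using linear_functional_on_add[of F L v "\<lambda>x. - w x"] linear_functional_on_minus[of F L w]
    function_space_minus[of F w] by simp

lemma linear_functional_on_sum:
  assumes "linear_functional_on F L" "function_space F" "\<And>i. i \<in> I \<Longrightarrow> v i \<in> F"
  shows "L (\<lambda>x. \<Sum>i\<in>I. v i x) = (\<Sum>i\<in>I. L (v i))"
  using assms(3)
proof (induction I rule: infinite_finite_induct)
  case (insert i I)
  then show ?case
    using linear_functional_on_add[OF assms(1), of "v i" "\<lambda>x. \<Sum>i\<in>I. v i x"]
      function_space_sum[OF assms(2), of I v] by simp
qed (auto simp: linear_functional_on_zero[OF assms(1,2)])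

section \<open>Invariant linear functionals\<close>

text \<open>
  A pair \<open>(v, a)\<close> stands for the requirement that the functional to be constructed is at most \<open>a\<close>
  at \<open>v\<close>. Closing the set of requirements under sums and positive multiples replaces the sublinear
  functional of the Hahn--Banach theorem by its epigraph, so that no infima have to be formed
  before the end. The last clause says that the requirements do not contradict each other.
\<close>

definition dominating_cone ::
  "('x \<Rightarrow> 'x) set \<Rightarrow> ('x \<Rightarrow> real) set \<Rightarrow> (('x \<Rightarrow> real) \<times> real) set \<Rightarrow> bool" where
  "dominating_cone \<Theta> F K \<longleftrightarrow>
     K \<subseteq> F \<times> UNIV \<and>
     (\<forall>v\<in>F. \<exists>a. (v, a) \<in> K) \<and>
     (\<forall>v a w b. (v, a) \<in> K \<longrightarrow> (w, b) \<in> K \<longrightarrow> ((\<lambda>x. v x + w x), a + b) \<in> K) \<and>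
     (\<forall>c>0. \<forall>v a. (v, a) \<in> K \<longrightarrow> ((\<lambda>x. c * v x), c * a) \<in> K) \<and>
     (\<forall>\<theta>\<in>\<Theta>. \<forall>v a. (v, a) \<in> K \<longrightarrow> (v \<circ> \<theta>, a) \<in> K) \<and>
     (\<forall>a. ((\<lambda>x. 0), a) \<in> K \<longrightarrow> 0 \<le> a)"

lemma dominating_coneD:
  assumes "dominating_cone \<Theta> F K"
  shows "(v, a) \<in> K \<Longrightarrow> v \<in> F"
    and "v \<in> F \<Longrightarrow> \<exists>a. (v, a) \<in> K"
    and "(v, a) \<in> K \<Longrightarrow> (w, b) \<in> K \<Longrightarrow> ((\<lambda>x. v x + w x), a + b) \<in> K"
    and "0 < c \<Longrightarrow> (v, a) \<in> K \<Longrightarrow> ((\<lambda>x. c * v x), c * a) \<in> K"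
    and "\<theta> \<in> \<Theta> \<Longrightarrow> (v, a) \<in> K \<Longrightarrow> (v \<circ> \<theta>, a) \<in> K"
    and "((\<lambda>x. 0), a) \<in> K \<Longrightarrow> 0 \<le> a"
  using assms unfolding dominating_cone_def by blast+

text \<open>
  Each clause concerns at most two pairs at a time, and two pairs in the union of a chain lie in a
  common member of it. So the union of a nonempty chain of dominating cones is again one, and
  Zorn's lemma applies.
\<close>

lemma dominating_cone_maximal:
  assumes "dominating_cone \<Theta> F K0"
  obtains K where "K0 \<subseteq> K" "dominating_cone \<Theta> F K"
    "\<And>K'. dominating_cone \<Theta> F K' \<Longrightarrow> K \<subseteq> K' \<Longrightarrow> K' = K"
proof -
  let ?A = "{K. K0 \<subseteq> K \<and> dominating_cone \<Theta> F K}"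
  have "\<exists>M\<in>?A. \<forall>X\<in>?A. M \<subseteq> X \<longrightarrow> X = M"
  proof (rule subset_Zorn_nonempty)
    show "?A \<noteq> {}" using assms by auto
  next
    fix \<C> assume "\<C> \<noteq> {}" and "subset.chain ?A \<C>"
    then have sub: "\<And>K. K \<in> \<C> \<Longrightarrow> K0 \<subseteq> K \<and> dominating_cone \<Theta> F K"
      and tot: "\<And>X Y. X \<in> \<C> \<Longrightarrow> Y \<in> \<C> \<Longrightarrow> X \<subseteq> Y \<or> Y \<subseteq> X"
      by (auto simp: subset_chain_def)
    have "dominating_cone \<Theta> F (\<Union>\<C>)"
      unfolding dominating_cone_def
    proof (intro conjI allI impI ballI)
      show "\<Union>\<C> \<subseteq> F \<times> UNIV" using sub dominating_coneD(1) by fastforce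
    next
      fix v assume "v \<in> F"
      then show "\<exists>a. (v, a) \<in> \<Union>\<C>"
        using \<open>\<C> \<noteq> {}\<close> sub dominating_coneD(2) by (metis UnionI ex_in_conv)
    next
      fix v a w b assume "(v, a) \<in> \<Union>\<C>" "(w, b) \<in> \<Union>\<C>"
      then obtain X Y where XY: "X \<in> \<C>" "(v, a) \<in> X" "Y \<in> \<C>" "(w, b) \<in> Y" by blast
      with tot[OF XY(1,3)] obtain Z where "Z \<in> \<C>" "(v, a) \<in> Z" "(w, b) \<in> Z" by blast
      then show "((\<lambda>x. v x + w x), a + b) \<in> \<Union>\<C>"
        using sub[of Z] dominating_coneD(3)[of \<Theta> F Z v a w b] by blast
    next
      fix c :: real and v a assume "0 < c" "(v, a) \<in> \<Union>\<C>"
      then show "((\<lambda>x. c * v x), c * a) \<in> \<Union>\<C>"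
        using sub dominating_coneD(4)[of \<Theta> F] by blast
    next
      fix \<theta> v a assume "\<theta> \<in> \<Theta>" "(v, a) \<in> \<Union>\<C>"
      then show "(v \<circ> \<theta>, a) \<in> \<Union>\<C>"
        using sub dominating_coneD(5)[of \<Theta> F] by blast
    next
      fix a assume "((\<lambda>x. 0), a) \<in> \<Union>\<C>"
      then show "0 \<le> a" using sub dominating_coneD(6)[of \<Theta> F] by blast
    qed
    then show "\<Union>\<C> \<in> ?A" using \<open>\<C> \<noteq> {}\<close> sub by blast
  qed
  then obtain K where "K0 \<subseteq> K" "dominating_cone \<Theta> F K"
    "\<forall>X\<in>?A. K \<subseteq> X \<longrightarrow> X = K" by auto
  then show ?thesis using that[of K] by (simp add: subset_trans)
qed

definition orbit_average :: "('x \<Rightarrow> 'x) \<Rightarrow> nat \<Rightarrow> ('x \<Rightarrow> real) \<Rightarrow> 'x \<Rightarrow> real" where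
  "orbit_average \<theta> n v = (\<lambda>x. (1 / real n) * (\<Sum>i<n. v ((\<theta> ^^ i) x)))"

lemma dominating_cone_iterate:
  "dominating_cone \<Theta> F K \<Longrightarrow> \<theta> \<in> \<Theta> \<Longrightarrow> (v, a) \<in> K \<Longrightarrow> ((\<lambda>x. v ((\<theta> ^^ i) x)), a) \<in> K"
proof (induction i)
  case (Suc i)
  then have "((\<lambda>x. v ((\<theta> ^^ i) x)) \<circ> \<theta>, a) \<in> K" by (blast intro: dominating_coneD(5))
  then show ?case by (simp add: o_def funpow_Suc_right del: funpow.simps)
qed simp

lemma dominating_cone_orbit_average:
  assumes K: "dominating_cone \<Theta> F K" and "\<theta> \<in> \<Theta>" "(v, a) \<in> K" "0 < n"
  shows "(orbit_average \<theta> n v, a) \<in> K"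
proof -
  have "((\<lambda>x. \<Sum>i<n. v ((\<theta> ^^ i) x)), real n * a) \<in> K"
    using \<open>0 < n\<close>
  proof (induction n rule: nat_induct_non_zero)
    case 1
    then show ?case using assms by simp
  next
    case (Suc n)
    then show ?case
      using dominating_coneD(3)[OF K Suc.IH dominating_cone_iterate[OF K assms(2,3), of n]]
      by (simp add: algebra_simps)
  qed
  from dominating_coneD(4)[OF K _ this, of "1 / real n"] \<open>0 < n\<close>
  show ?thesis by (simp add: orbit_average_def)
qed

text \<open>
  A simultaneous proof of the Hahn--Banach theorem and of its invariant version for commuting maps.
  Let \<open>K\<close> be a maximal cone above \<open>K0\<close>. Every modification of \<open>K\<close> that yields a larger dominating
  cone changes nothing. Applied to the vertical closure, this shows that \<open>K\<close> is closed. Applied to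
  the pairs whose orbit average lies in \<open>K\<close>, it shows that \<open>K\<close> contains \<open>(v \<circ> \<theta> - v, 0)\<close>, as the
  orbit averages of the coboundary \<open>v \<circ> \<theta> - v\<close> are \<open>(v \<circ> \<theta>\<^sup>n - v) / n\<close>; the maps have to
  commute for this set of pairs to be stable under all of \<open>\<Theta>\<close>. Applied to the cone generated by
  \<open>K\<close> and \<open>(- w, - s)\<close>, where \<open>s\<close> is the least bound that \<open>K\<close> imposes at \<open>w\<close>, it shows that \<open>K\<close>
  contains both \<open>(w, s)\<close> and its negative. Hence \<open>K\<close> is the epigraph of a linear functional, and
  the pairs \<open>(v \<circ> \<theta> - v, 0)\<close> make that functional invariant.
\<close>

theorem dominating_cone_invariant_functional:
  assumes F: "function_space F" "invariant_space \<Theta> F"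
    and comm: "\<And>\<theta> \<eta>. \<theta> \<in> \<Theta> \<Longrightarrow> \<eta> \<in> \<Theta> \<Longrightarrow> \<theta> \<circ> \<eta> = \<eta> \<circ> \<theta>"
    and K0: "dominating_cone \<Theta> F K0"
  obtains L where "linear_functional_on F L" "invariant_functional \<Theta> F L"
    "\<And>v a. (v, a) \<in> K0 \<Longrightarrow> L v \<le> a"
proof -
  from dominating_cone_maximal[OF K0] obtain K where "K0 \<subseteq> K" and K: "dominating_cone \<Theta> F K"
    and max: "\<And>K'. dominating_cone \<Theta> F K' \<Longrightarrow> K \<subseteq> K' \<Longrightarrow> K' = K"
    by metis
  note KF = dominating_coneD(1)[OF K] and Kex = dominating_coneD(2)[OF K]
    and Kadd = dominating_coneD(3)[OF K] and Kscale = dominating_coneD(4)[OF K]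
    and Kinv = dominating_coneD(5)[OF K] and Kzero = dominating_coneD(6)[OF K]
  note Fzero = function_space_zero[OF F(1)] and Fadd = function_space_add[OF F(1)]
    and Fscale = function_space_scale[OF F(1)] and Fminus = function_space_minus[OF F(1)]
    and Fdiff = function_space_diff[OF F(1)]
  have Finv: "v \<circ> \<theta> \<in> F" if "v \<in> F" "\<theta> \<in> \<Theta>" for v \<theta>
    using F(2) that by (simp add: invariant_space_def)
  \<comment> \<open>A bound that can be approximated from above is itself in \<open>K\<close>.\<close>
  have closed: "(v, a) \<in> K" if v: "v \<in> F" and ap: "\<And>e. 0 < e \<Longrightarrow> \<exists>b\<le>a + e. (v, b) \<in> K" for v a
  proof -
    let ?K' = "{(v, a). v \<in> F \<and> (\<forall>e>0. \<exists>b\<le>a + e. (v, b) \<in> K)}"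
    have "dominating_cone \<Theta> F ?K'"
      unfolding dominating_cone_def
    proof (intro conjI allI impI ballI)
      show "\<exists>a. (v, a) \<in> ?K'" if "v \<in> F" for v
      proof -
        obtain a where a: "(v, a) \<in> K" using Kex[OF \<open>v \<in> F\<close>] by blast
        have "\<exists>b\<le>a + e. (v, b) \<in> K" if "0 < e" for e
          using a that by (intro exI[of _ a]) auto
        then show ?thesis using that by blast
      qed
    next
      fix v a w b assume *: "(v, a) \<in> ?K'" "(w, b) \<in> ?K'"
      have "\<exists>c\<le>a + b + e. ((\<lambda>x. v x + w x), c) \<in> K" if "0 < e" for e
      proof -
        from that have "0 < e / 2" by simp
        with * obtain a' b' where
          ab: "a' \<le> a + e / 2" "(v, a') \<in> K" "b' \<le> b + e / 2" "(w, b') \<in> K" by blast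
        show ?thesis using ab(1,3) Kadd[OF ab(2,4)] by (intro exI[of _ "a' + b'"]) auto
      qed
      then show "((\<lambda>x. v x + w x), a + b) \<in> ?K'" using * Fadd by auto
    next
      fix c :: real and v a assume c: "0 < c" and *: "(v, a) \<in> ?K'"
      have "\<exists>b\<le>c * a + e. ((\<lambda>x. c * v x), b) \<in> K" if "0 < e" for e
      proof -
        from that c have "0 < e / c" by simp
        with * obtain a' where a': "a' \<le> a + e / c" "(v, a') \<in> K" by blast
        then have "c * a' \<le> c * a + e" using c by (simp add: field_simps)
        then show ?thesis using Kscale[OF c a'(2)] by blast
      qed
      then show "((\<lambda>x. c * v x), c * a) \<in> ?K'" using * Fscale by auto
    next
      fix \<theta> v a assume "\<theta> \<in> \<Theta>" "(v, a) \<in> ?K'"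
      then show "(v \<circ> \<theta>, a) \<in> ?K'" using Finv[of v \<theta>] Kinv[of \<theta> v] by (auto 4 4)
    next
      fix a assume *: "((\<lambda>x. 0), a) \<in> ?K'"
      have "0 \<le> a + e" if "0 < e" for e
        using * that Kzero by force
      then show "0 \<le> a" by (rule field_le_epsilon)
    qed auto
    moreover have "K \<subseteq> ?K'"
    proof safe
      fix v a and e :: real assume "(v, a) \<in> K" "0 < e"
      then show "\<exists>b\<le>a + e. (v, b) \<in> K" by (intro exI[of _ a]) auto
    qed (rule KF)
    ultimately have "?K' = K" by (rule max)
    then show ?thesis using v ap by blast
  qed
  \<comment> \<open>Membership in \<open>K\<close> can be tested on orbit averages.\<close>
  have average: "(v, a) \<in> K" if \<theta>: "\<theta> \<in> \<Theta>" and n: "0 < n" and v: "v \<in> F"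
    and av: "(orbit_average \<theta> n v, a) \<in> K" for \<theta> n v a
  proof -
    let ?K' = "{(v, a). v \<in> F \<and> (orbit_average \<theta> n v, a) \<in> K}"
    have "dominating_cone \<Theta> F ?K'"
      unfolding dominating_cone_def
    proof (intro conjI allI impI ballI)
      show "\<exists>a. (v, a) \<in> ?K'" if "v \<in> F" for v
        using Kex[OF that] that dominating_cone_orbit_average[OF K \<theta> _ n] by auto
    next
      fix v a w b assume *: "(v, a) \<in> ?K'" "(w, b) \<in> ?K'"
      have "orbit_average \<theta> n (\<lambda>x. v x + w x)
          = (\<lambda>x. orbit_average \<theta> n v x + orbit_average \<theta> n w x)"
        by (simp add: orbit_average_def sum.distrib algebra_simps add_divide_distrib)
      then show "((\<lambda>x. v x + w x), a + b) \<in> ?K'" using * Fadd Kadd by auto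
    next
      fix c :: real and v a assume c: "0 < c" and *: "(v, a) \<in> ?K'"
      have "orbit_average \<theta> n (\<lambda>x. c * v x) = (\<lambda>x. c * orbit_average \<theta> n v x)"
        by (simp add: orbit_average_def sum_distrib_left mult.left_commute)
      then show "((\<lambda>x. c * v x), c * a) \<in> ?K'" using * Fscale Kscale[OF c] by auto
    next
      fix \<eta> v a assume \<eta>: "\<eta> \<in> \<Theta>" and *: "(v, a) \<in> ?K'"
      have "(\<theta> ^^ i) (\<eta> x) = \<eta> ((\<theta> ^^ i) x)" for i x
      proof (induction i)
        case (Suc i)
        then show ?case using fun_cong[OF comm[OF \<theta> \<eta>]] by simp
      qed simp
      then have "orbit_average \<theta> n (v \<circ> \<eta>) = orbit_average \<theta> n v \<circ> \<eta>"
        by (simp add: orbit_average_def o_def)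
      then show "(v \<circ> \<eta>, a) \<in> ?K'" using * Finv[OF _ \<eta>] Kinv[OF \<eta>] by auto
    next
      fix a assume "((\<lambda>x. 0), a) \<in> ?K'"
      then show "0 \<le> a" using Kzero by (simp add: orbit_average_def)
    qed auto
    moreover have "K \<subseteq> ?K'" using dominating_cone_orbit_average[OF K \<theta> _ n] KF by auto
    ultimately have "?K' = K" by (rule max)
    then show ?thesis using v av by blast
  qed
  have coboundary: "((\<lambda>x. v (\<theta> x) - v x), 0) \<in> K" if \<theta>: "\<theta> \<in> \<Theta>" and v: "v \<in> F" for \<theta> v
  proof -
    let ?d = "\<lambda>x. v (\<theta> x) - v x"
    have d: "?d \<in> F" using Fdiff[OF Finv[OF v \<theta>] v] by simp
    obtain a where a: "(v, a) \<in> K" using Kex[OF v] by blast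
    obtain b where b: "((\<lambda>x. - v x), b) \<in> K" using Kex[OF Fminus[OF v]] by blast
    have dn: "(?d, (1 / real n) * (a + b)) \<in> K" if n: "0 < n" for n
    proof (rule average[OF \<theta> n d])
      have "orbit_average \<theta> n ?d = (\<lambda>x. (1 / real n) * (v ((\<theta> ^^ n) x) + - v x))"
        using sum_lessThan_telescope[of "\<lambda>i. v ((\<theta> ^^ i) x)" n for x]
        by (simp add: orbit_average_def fun_eq_iff funpow_swap1)
      moreover have "((\<lambda>x. (1 / real n) * (v ((\<theta> ^^ n) x) + - v x)), (1 / real n) * (a + b)) \<in> K"
        by (rule Kscale[OF _ Kadd[OF dominating_cone_iterate[OF K \<theta> a] b]]) (use n in simp)
      ultimately show "(orbit_average \<theta> n ?d, (1 / real n) * (a + b)) \<in> K" by simp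
    qed
    show ?thesis
    proof (rule closed[OF d])
      fix e :: real assume "0 < e"
      obtain n where n: "a + b < real n * e" using reals_Archimedean3[OF \<open>0 < e\<close>] by blast
      have "(1 / real (Suc n)) * (a + b) \<le> e"
        using n \<open>0 < e\<close> by (simp add: field_simps)
      then show "\<exists>c\<le>0 + e. (?d, c) \<in> K" using dn[of "Suc n"] by auto
    qed
  qed
  \<comment> \<open>A maximal cone is a half space: it contains a line through each \<open>w\<close>.\<close>
  have "\<exists>s. (w, s) \<in> K \<and> ((\<lambda>x. - w x), - s) \<in> K" if w: "w \<in> F" for w
  proof -
    let ?S = "{a. (w, a) \<in> K}"
    obtain b where b: "((\<lambda>x. - w x), b) \<in> K" using Kex[OF Fminus[OF w]] by blast
    have lower: "- b \<le> a" if "(w, a) \<in> K" for a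
      using Kzero[of "a + b"] Kadd[OF that b] by simp
    then have bdd: "bdd_below ?S" unfolding bdd_below_def by auto
    have ne: "?S \<noteq> {}" using Kex[OF w] by blast
    define s where "s = Inf ?S"
    have sle: "s \<le> a" if "(w, a) \<in> K" for a
      unfolding s_def using that bdd by (simp add: cInf_lower)
    have ws: "(w, s) \<in> K"
    proof (rule closed[OF w])
      fix e :: real assume "0 < e"
      then have "Inf ?S < s + e" by (simp add: s_def)
      then show "\<exists>b\<le>s + e. (w, b) \<in> K"
        using cInf_lessD[OF ne] by (auto intro: less_imp_le)
    qed
    let ?K' = "{((\<lambda>x. v x - t * w x), a - t * s) | v a t. (v, a) \<in> K \<and> 0 \<le> t}"
    have mem: "p \<in> ?K'" if "(v, a) \<in> K" "0 \<le> t" "p = ((\<lambda>x. v x - t * w x), a - t * s)" for p v a t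
      using that by blast
    have "dominating_cone \<Theta> F ?K'"
      unfolding dominating_cone_def
    proof (intro conjI allI impI ballI)
      show "?K' \<subseteq> F \<times> UNIV" by (auto intro!: Fdiff Fscale[OF w] dest: KF)
    next
      show "\<exists>a. (v, a) \<in> ?K'" if v: "v \<in> F" for v
      proof -
        obtain a where "(v, a) \<in> K" using Kex[OF v] ..
        then have "(v, a) \<in> ?K'" by (rule mem[of v a 0]) auto
        then show ?thesis ..
      qed
    next
      fix v1 a1 v2 a2 assume "(v1, a1) \<in> ?K'" "(v2, a2) \<in> ?K'"
      then obtain u1 b1 t1 u2 b2 t2 where *: "(u1, b1) \<in> K" "0 \<le> t1" "(u2, b2) \<in> K" "0 \<le> t2"
        "v1 = (\<lambda>x. u1 x - t1 * w x)" "a1 = b1 - t1 * s"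
        "v2 = (\<lambda>x. u2 x - t2 * w x)" "a2 = b2 - t2 * s" by blast
      show "((\<lambda>x. v1 x + v2 x), a1 + a2) \<in> ?K'"
        by (rule mem[OF Kadd[OF *(1,3)], of "t1 + t2"]) (use * in \<open>auto simp: algebra_simps\<close>)
    next
      fix c :: real and v1 a1 assume c: "0 < c" and "(v1, a1) \<in> ?K'"
      then obtain u1 b1 t1 where *: "(u1, b1) \<in> K" "0 \<le> t1"
        "v1 = (\<lambda>x. u1 x - t1 * w x)" "a1 = b1 - t1 * s" by blast
      show "((\<lambda>x. c * v1 x), c * a1) \<in> ?K'"
        by (rule mem[OF Kscale[OF c *(1)], of "c * t1"]) (use * c in \<open>auto simp: algebra_simps\<close>)
    next
      fix \<theta> v1 a1 assume \<theta>: "\<theta> \<in> \<Theta>" and "(v1, a1) \<in> ?K'"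
      then obtain u1 b1 t1 where *: "(u1, b1) \<in> K" "0 \<le> t1"
        "v1 = (\<lambda>x. u1 x - t1 * w x)" "a1 = b1 - t1 * s" by blast
      have "((\<lambda>x. (- t1 * w (\<theta> x)) - (- t1 * w x)), 0) \<in> K"
        using coboundary[OF \<theta> Fscale[OF w, of "- t1"]] by simp
      \<comment> \<open>The coboundary compensates for the fact that the adjoined vector
        \<open>w\<close> is not invariant.\<close>
      from Kadd[OF Kinv[OF \<theta> *(1)] this]
      show "(v1 \<circ> \<theta>, a1) \<in> ?K'"
        by (rule mem[of _ _ t1]) (use * in \<open>auto simp: algebra_simps o_def\<close>)
    next
      fix a assume "((\<lambda>x. 0), a) \<in> ?K'"
      then obtain u b t where *: "(u, b) \<in> K" "0 \<le> t" "(\<lambda>x. 0) = (\<lambda>x. u x - t * w x)" "a = b - t * s"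
        by blast
      have "u x = t * w x" for x using fun_cong[OF *(3), of x] by simp
      then have u: "u = (\<lambda>x. t * w x)" ..
      show "0 \<le> a"
      proof (cases "t = 0")
        case True
        then show ?thesis using *(1,4) Kzero[of b] by (simp add: u)
      next
        case False
        then have t: "0 < 1 / t" using *(2) by simp
        have "(w, (1 / t) * b) \<in> K" using Kscale[OF t *(1)] False by (simp add: u)
        from sle[OF this] show ?thesis using *(2,4) False by (simp add: field_simps)
      qed
    qed
    moreover have "K \<subseteq> ?K'"
    proof safe
      fix v a assume "(v, a) \<in> K"
      then have "(v, a) \<in> ?K'" by (rule mem[of v a 0]) auto
      then show "\<exists>v' a' t. (v, a) = ((\<lambda>x. v' x - t * w x), a' - t * s) \<and> (v', a') \<in> K \<and> 0 \<le> t"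
        by blast
    qed
    ultimately have "?K' = K" by (rule max)
    moreover have "((\<lambda>x. - w x), - s) \<in> ?K'"
    proof (rule mem[of "\<lambda>x. w x - w x" 0 1])
      \<comment> \<open>Some bound at 0 is in \<open>K\<close>; its small positive multiples tend
        to 0.\<close>
      have "((\<lambda>x. 0), 0) \<in> K"
      proof (rule closed[OF Fzero])
        fix e :: real assume "0 < e"
        obtain a where a: "((\<lambda>x. 0), a) \<in> K" using Kex[OF Fzero] ..
        show "\<exists>b\<le>0 + e. ((\<lambda>x. 0), b) \<in> K"
        proof (cases "a = 0")
          case True
          then show ?thesis using a \<open>0 < e\<close> by (intro exI[of _ 0]) auto
        next
          case False
          then have "0 < a" using Kzero[OF a] by simp
          then have "((\<lambda>x. 0), (e / a) * a) \<in> K" using Kscale[OF _ a, of "e / a"] \<open>0 < e\<close> by simp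
          then show ?thesis using \<open>0 < a\<close> by (intro exI[of _ e]) auto
        qed
      qed
      then show "((\<lambda>x. w x - w x), 0) \<in> K" by simp
    qed auto
    ultimately show ?thesis using ws by blast
  qed
  then obtain L where L: "\<And>w. w \<in> F \<Longrightarrow> (w, L w) \<in> K"
    and Lm: "\<And>w. w \<in> F \<Longrightarrow> ((\<lambda>x. - w x), - L w) \<in> K" by metis
  have Lle: "L v \<le> a" if "(v, a) \<in> K" for v a
    using Kzero[of "a - L v"] Kadd[OF that Lm[OF KF[OF that]]] by simp
  have Lge: "a \<le> L v" if "((\<lambda>x. - v x), - a) \<in> K" "v \<in> F" for v a
    using Kzero[of "L v - a"] Kadd[OF L[OF that(2)] that(1)] by simp
  have Leq: "L v = a" if "(v, a) \<in> K" "((\<lambda>x. - v x), - a) \<in> K" for v a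
    using Lle[OF that(1)] Lge[OF that(2) KF[OF that(1)]] by simp
  have add: "L (\<lambda>x. v x + w x) = L v + L w" if "v \<in> F" "w \<in> F" for v w
    using Leq[OF Kadd[OF L L, OF that]] Kadd[OF Lm Lm, OF that] by (simp add: algebra_simps)
  have minus: "L (\<lambda>x. - v x) = - L v" if "v \<in> F" for v
    by (rule Leq) (use L Lm that in auto)
  have pos_scale: "L (\<lambda>x. c * v x) = c * L v" if "v \<in> F" "0 < c" for v c
    by (rule Leq) (use Kscale[OF that(2) L[OF that(1)]] Kscale[OF that(2) Lm[OF that(1)]] in auto)
  have zero: "L (\<lambda>x. 0) = 0" using add[OF Fzero Fzero] by simp
  have scale: "L (\<lambda>x. c * v x) = c * L v" if "v \<in> F" for v c
  proof -
    consider "0 < c" | "c = 0" | "0 < - c" by linarith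
    then show ?thesis
    proof cases
      case 3
      then show ?thesis using pos_scale[OF Fminus[OF that] 3] minus[OF that] by simp
    qed (use pos_scale that zero in auto)
  qed
  have le: "L (v \<circ> \<theta>) \<le> L v" if "\<theta> \<in> \<Theta>" "v \<in> F" for \<theta> v
    using Lle[of "v \<circ> \<theta>"] Kadd[OF coboundary[OF that] L[OF that(2)]] by (simp add: o_def)
  have inv: "L (v \<circ> \<theta>) = L v" if "\<theta> \<in> \<Theta>" "v \<in> F" for \<theta> v
    using le[OF that] le[OF that(1) Fminus[OF that(2)]] minus[OF that(2)]
      minus[OF Finv[OF that(2,1)]] by (simp add: o_def)
  show ?thesis
  proof (rule that[of L])
    show "linear_functional_on F L" by (simp add: linear_functional_on_def add scale)
    show "invariant_functional \<Theta> F L" by (simp add: invariant_functional_def Finv inv)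
    show "L v \<le> a" if "(v, a) \<in> K0" for v a using Lle \<open>K0 \<subseteq> K\<close> that by blast
  qed
qed

section \<open>Bounded continuous functions\<close>

definition bounded_continuous :: "('x::topological_space \<Rightarrow> real) set" where
  "bounded_continuous = {f. continuous_on UNIV f \<and> (\<exists>M. \<forall>x. \<bar>f x\<bar> \<le> M)}"

lemma bounded_continuousI:
  "continuous_on UNIV f \<Longrightarrow> (\<And>x. \<bar>f x\<bar> \<le> M) \<Longrightarrow> f \<in> bounded_continuous"
  by (auto simp: bounded_continuous_def)

lemma bounded_continuous_continuous: "f \<in> bounded_continuous \<Longrightarrow> continuous_on UNIV f"
  by (simp add: bounded_continuous_def)

lemma bounded_continuous_bound:
  fixes f :: "'x::topological_space \<Rightarrow> real"
  assumes "f \<in> bounded_continuous"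
  obtains M where "1 \<le> M" "\<And>x. \<bar>f x\<bar> \<le> M"
proof -
  from assms obtain M where "\<And>x. \<bar>f x\<bar> \<le> M" by (auto simp: bounded_continuous_def)
  then show ?thesis using that[of "max 1 M"] by (meson max.coboundedI2 max.cobounded1)
qed

lemma bounded_continuous_const: "(\<lambda>x. c) \<in> bounded_continuous"
  by (rule bounded_continuousI[of _ "\<bar>c\<bar>"]) auto

lemma function_space_bounded_continuous: "function_space bounded_continuous"
  unfolding function_space_def
proof (intro conjI ballI allI)
  show "(\<lambda>x. 0) \<in> bounded_continuous" by (rule bounded_continuous_const)
next
  fix f g :: "'x::topological_space \<Rightarrow> real" assume fg: "f \<in> bounded_continuous" "g \<in> bounded_continuous"
  obtain M where M: "\<And>x. \<bar>f x\<bar> \<le> M" using bounded_continuous_bound[OF fg(1)] by blast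
  obtain N where N: "\<And>x. \<bar>g x\<bar> \<le> N" using bounded_continuous_bound[OF fg(2)] by blast
  show "(\<lambda>x. f x + g x) \<in> bounded_continuous"
  proof (rule bounded_continuousI)
    show "continuous_on UNIV (\<lambda>x. f x + g x)"
      using fg by (intro continuous_on_add bounded_continuous_continuous)
    show "\<bar>f x + g x\<bar> \<le> M + N" for x using M[of x] N[of x] by linarith
  qed
next
  fix c and f :: "'x::topological_space \<Rightarrow> real" assume f: "f \<in> bounded_continuous"
  obtain M where M: "\<And>x. \<bar>f x\<bar> \<le> M" using bounded_continuous_bound[OF f] by blast
  show "(\<lambda>x. c * f x) \<in> bounded_continuous"
  proof (rule bounded_continuousI)
    show "continuous_on UNIV (\<lambda>x. c * f x)"
      using f by (intro continuous_on_mult_left bounded_continuous_continuous)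
    show "\<bar>c * f x\<bar> \<le> \<bar>c\<bar> * M" for x using M[of x] by (simp add: abs_mult mult_left_mono)
  qed
qed

lemma bounded_continuous_max:
  assumes fg: "f \<in> bounded_continuous" "g \<in> bounded_continuous"
  shows "(\<lambda>x. max (f x) (g x)) \<in> bounded_continuous"
proof -
  obtain M where M: "\<And>x. \<bar>f x\<bar> \<le> M" using bounded_continuous_bound[OF fg(1)] by blast
  obtain N where N: "\<And>x. \<bar>g x\<bar> \<le> N" using bounded_continuous_bound[OF fg(2)] by blast
  show ?thesis
  proof (rule bounded_continuousI)
    show "continuous_on UNIV (\<lambda>x. max (f x) (g x))"
      using fg by (intro continuous_on_max bounded_continuous_continuous)
    show "\<bar>max (f x) (g x)\<bar> \<le> M + N" for x using M[of x] N[of x] by linarith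
  qed
qed

section \<open>Representation of tight functionals by measures\<close>

text \<open>
  The hypotheses of the representation theorem. Tightness says that the functional charges the
  complement of some compact set arbitrarily little. It replaces compactness of the space in the
  Riesz representation theorem.
\<close>

locale tight_functional =
  fixes L :: "('x::topological_space \<Rightarrow> real) \<Rightarrow> real"
  assumes completely_regular: "completely_regular_space (euclidean :: 'x topology)"
    and linear: "linear_functional_on bounded_continuous L"
    and nonneg: "f \<in> bounded_continuous \<Longrightarrow> (\<And>x. 0 \<le> f x) \<Longrightarrow> 0 \<le> L f"
    and one: "L (\<lambda>x. 1) = 1"
    and tight: "0 < e \<Longrightarrow> \<exists>C. compact C \<and>
      (\<forall>f\<in>bounded_continuous. (\<forall>x. 0 \<le> f x \<and> f x \<le> 1) \<longrightarrow> (\<forall>x\<in>C. f x = 0) \<longrightarrow> L f \<le> e)"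
begin

lemmas C_add = function_space_add[OF function_space_bounded_continuous]
  and C_scale = function_space_scale[OF function_space_bounded_continuous]
  and C_diff = function_space_diff[OF function_space_bounded_continuous]
  and C_sum = function_space_sum[OF function_space_bounded_continuous]
  and L_add = linear_functional_on_add[OF linear]
  and L_scale = linear_functional_on_scale[OF linear]
  and L_minus = linear_functional_on_minus[OF linear]
  and L_diff = linear_functional_on_diff[OF linear function_space_bounded_continuous]
  and L_sum = linear_functional_on_sum[OF linear function_space_bounded_continuous]
  and L_zero = linear_functional_on_zero[OF linear function_space_bounded_continuous]

lemma L_mono:
  assumes "f \<in> bounded_continuous" "g \<in> bounded_continuous" "\<And>x. f x \<le> g x"
  shows "L f \<le> L g"
  using nonneg[OF C_diff[OF assms(2,1)]] L_diff[OF assms(2,1)] assms(3) by simp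

lemma L_const: "L (\<lambda>x. c) = c"
  using L_scale[OF bounded_continuous_const[of 1], of c] one by simp

lemma directed_finite_upper:
  assumes "finite A" "A \<subseteq> H" "H \<noteq> {}"
    and dir: "\<And>h k. h \<in> H \<Longrightarrow> k \<in> H \<Longrightarrow> \<exists>l\<in>H. \<forall>x. max (h x) (k x) \<le> (l x :: real)"
  shows "\<exists>l\<in>H. \<forall>h\<in>A. \<forall>x. h x \<le> l x"
  using assms(1,2)
proof (induction A rule: finite_induct)
  case empty
  then show ?case using \<open>H \<noteq> {}\<close> by auto
next
  case (insert h A)
  then obtain k where k: "k \<in> H" "\<forall>h\<in>A. \<forall>x. h x \<le> k x" by auto
  obtain l where "l \<in> H" "\<forall>x. max (h x) (k x) \<le> l x" using dir[of h k] insert.prems k(1) by auto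
  then show ?case using k(2) by (intro bexI[of _ l]) (auto intro: order_trans)
qed

text \<open>
  Dini's theorem for directed families. By compactness one member \<open>h\<close> of the family exceeds \<open>f - d\<close>
  on a compact set outside of which the functional is negligible. Then \<open>f \<le> h + d + M u\<close>, where
  \<open>M u\<close> is the positive part of \<open>f - h - d\<close>: the function \<open>u\<close> has values in \<open>[0, 1]\<close> and vanishes on
  the compact set.
\<close>

lemma tau_smooth:
  assumes f: "f \<in> bounded_continuous" and H: "H \<subseteq> bounded_continuous" "H \<noteq> {}"
    and Hpos: "\<And>h x. h \<in> H \<Longrightarrow> 0 \<le> h x"
    and dir: "\<And>h k. h \<in> H \<Longrightarrow> k \<in> H \<Longrightarrow> \<exists>l\<in>H. \<forall>x. max (h x) (k x) \<le> l x"
    and sup: "\<And>x d. 0 < d \<Longrightarrow> \<exists>h\<in>H. f x - d < h x"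
    and e: "0 < e"
  shows "\<exists>h\<in>H. L f \<le> L h + e"
proof -
  obtain M where M: "1 \<le> M" "\<And>x. \<bar>f x\<bar> \<le> M" using bounded_continuous_bound[OF f] by blast
  define d where "d = e / 2"
  define d' where "d' = e / (2 * M)"
  have d: "0 < d" "0 < d'" using e M(1) by (auto simp: d_def d'_def)
  obtain C where C: "compact C"
    and small: "\<And>u. u \<in> bounded_continuous \<Longrightarrow> (\<And>x. 0 \<le> u x \<and> u x \<le> 1) \<Longrightarrow> (\<And>x. x \<in> C \<Longrightarrow> u x = 0)
      \<Longrightarrow> L u \<le> d'"
    using tight[OF d(2)] by meson
  have op: "open {x. f x - d < h x}" if "h \<in> H" for h
    using f H(1) that
    by (intro open_Collect_less continuous_intros bounded_continuous_continuous) auto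
  have "C \<subseteq> (\<Union>h\<in>H. {x. f x - d < h x})" using sup[OF d(1)] by blast
  from compactE_image[OF C op this] obtain A where A: "A \<subseteq> H" "finite A"
    "C \<subseteq> (\<Union>h\<in>A. {x. f x - d < h x})" by metis
  obtain h where h: "h \<in> H" "\<And>k x. k \<in> A \<Longrightarrow> k x \<le> h x"
    using directed_finite_upper[OF A(2,1) H(2) dir] by blast
  have hC: "h \<in> bounded_continuous" using h(1) H(1) by blast
  define u where "u = (\<lambda>x. (1 / M) * max 0 (f x - h x - d))"
  have maxC: "(\<lambda>x. max 0 (f x - h x - d)) \<in> bounded_continuous"
    by (intro bounded_continuous_max bounded_continuous_const C_diff f hC)
  have uC: "u \<in> bounded_continuous" unfolding u_def by (rule C_scale[OF maxC])
  have "L u \<le> d'"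
  proof (rule small[OF uC])
    fix x
    have "max 0 (f x - h x - d) \<le> M"
      using M(1) M(2)[of x] Hpos[OF h(1), of x] d(1) by auto
    then show "0 \<le> u x \<and> u x \<le> 1" using M(1) by (simp add: u_def)
  next
    fix x assume "x \<in> C"
    then obtain k where "k \<in> A" "f x - d < k x" using A(3) by blast
    then show "u x = 0" using h(2)[of k x] by (simp add: u_def)
  qed
  have "L f \<le> L (\<lambda>x. (h x + d) + M * u x)"
  proof (rule L_mono[OF f])
    show "(\<lambda>x. (h x + d) + M * u x) \<in> bounded_continuous"
      by (intro C_add C_scale uC hC bounded_continuous_const)
    show "f x \<le> (h x + d) + M * u x" for x using M(1) by (simp add: u_def)
  qed
  also have "\<dots> = (L h + d) + M * L u"
    using L_add[OF C_add[OF hC bounded_continuous_const[of d]] C_scale[OF uC, of M]]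
      L_add[OF hC bounded_continuous_const[of d]] L_scale[OF uC, of M] by (simp add: L_const)
  also have "\<dots> \<le> (L h + d) + M * d'" using \<open>L u \<le> d'\<close> M(1) by (intro add_left_mono mult_left_mono) auto
  also have "\<dots> = L h + e" using M(1) by (simp add: d_def d'_def)
  finally show ?thesis using h(1) by blast
qed

definition below :: "'x set \<Rightarrow> ('x \<Rightarrow> real) set" where
  "below U = {f \<in> bounded_continuous. \<forall>x. 0 \<le> f x \<and> f x \<le> indicator U x}"

definition content :: "'x set \<Rightarrow> ennreal" where
  "content U = (SUP f\<in>below U. ennreal (L f))"

lemma belowD:
  assumes "f \<in> below U"
  shows "f \<in> bounded_continuous" "0 \<le> f x" "f x \<le> 1" "x \<notin> U \<Longrightarrow> f x = 0"
proof -
  have f: "f \<in> bounded_continuous" "0 \<le> f x" "f x \<le> indicator U x"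
    using assms by (auto simp: below_def)
  show "f \<in> bounded_continuous" "0 \<le> f x" "f x \<le> 1"
    using f order_trans[OF f(3) indicator_le_1] by auto
  show "f x = 0" if "x \<notin> U" using f that by simp
qed

lemma belowI:
  assumes "continuous_on UNIV f" "\<And>x. 0 \<le> f x" "\<And>x. f x \<le> 1" "\<And>x. x \<notin> U \<Longrightarrow> f x = 0"
  shows "f \<in> below U"
  using assms bounded_continuousI[of f 1] by (auto simp: below_def indicator_def)

lemma zero_below: "(\<lambda>x. 0) \<in> below U"
  by (rule belowI) auto

lemma content_upper: "f \<in> below U \<Longrightarrow> ennreal (L f) \<le> content U"
  unfolding content_def by (rule SUP_upper)

lemma content_mono: "U \<subseteq> V \<Longrightarrow> content U \<le> content V"
  unfolding content_def
  by (intro SUP_subset_mono) (auto intro!: belowI bounded_continuous_continuous dest: belowD)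

lemma content_UNIV: "content UNIV = 1"
proof (rule antisym)
  show "content UNIV \<le> 1" unfolding content_def
  proof (rule SUP_least)
    fix f assume "f \<in> below UNIV"
    then have "L f \<le> L (\<lambda>x. 1)" by (intro L_mono bounded_continuous_const belowD)
    then show "ennreal (L f) \<le> 1" using one by (simp add: ennreal_le_1)
  qed
  show "1 \<le> content UNIV"
    using content_upper[OF belowI, of "\<lambda>x. 1" UNIV] one by simp
qed

lemma content_empty: "content {} = 0"
proof -
  have "L f \<le> 0" if "f \<in> below {}" for f
    using L_mono[OF belowD(1)[OF that] bounded_continuous_const[of 0]] belowD(4)[OF that]
    by (simp add: L_const)
  then have "content {} \<le> 0" unfolding content_def by (intro SUP_least) (simp add: ennreal_neg)
  then show ?thesis by simp
qed

lemma below_approx: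
  assumes "0 < e"
  obtains f where "f \<in> below U" "content U \<le> ennreal (L f) + ennreal e"
proof -
  have "content U \<noteq> \<top>"
    using content_mono[of U UNIV] content_UNIV by (auto simp: top_unique)
  have "\<exists>f\<in>below U. content U < ennreal (L f) + ennreal e"
  proof (cases "content U = 0")
    case True
    then show ?thesis using assms zero_below by (intro bexI[of _ "\<lambda>x. 0"]) (auto simp: L_zero)
  next
    case False
    then have "content U - ennreal e < content U"
      using \<open>content U \<noteq> \<top>\<close> assms by (intro ennreal_between) (auto simp: less_top zero_less_iff_neq_zero)
    then obtain f where f: "f \<in> below U" "content U - ennreal e < ennreal (L f)"
      unfolding content_def less_SUP_iff by blast
    then show ?thesis
      by (intro bexI[of _ f]) (auto simp: not_le[symmetric] ennreal_le_minus_iff)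
  qed
  then show ?thesis using that by (auto intro: less_imp_le)
qed

lemma urysohn_point:
  assumes "open U" "x \<in> U"
  obtains f where "f \<in> below U" "f x = 1"
proof -
  have "\<exists>f::'x\<Rightarrow>real. continuous_map euclidean (top_of_set {0..1}) f \<and> f x = 0 \<and> f ` (- U) \<subseteq> {1}"
    using completely_regular assms unfolding completely_regular_space_def
    by (auto simp: closed_Compl)
  then obtain f :: "'x \<Rightarrow> real" where f: "continuous_on UNIV f" "\<And>y. f y \<in> {0..1}" "f x = 0"
    "\<And>y. y \<notin> U \<Longrightarrow> f y = 1"
    by (fastforce simp: continuous_map_in_subtopology image_subset_iff)
  show ?thesis
  proof (rule that[of "\<lambda>y. 1 - f y"])
    show "(\<lambda>y. 1 - f y) \<in> below U"
      using f(2,4) by (intro belowI continuous_intros f(1)) auto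
  qed (simp add: f(3))
qed

text \<open>
  Finite sums of functions below the single sets form a directed family whose supremum is at least
  1 on the union, by complete regularity. So \<open>\<tau>\<close>-smoothness bounds \<open>L f\<close> by the values at such
  sums.
\<close>

lemma content_countably_subadditive:
  assumes U: "\<And>i::nat. open (U i)"
  shows "content (\<Union>i. U i) \<le> (\<Sum>i. content (U i))"
  unfolding content_def[of "\<Union>i. U i"]
proof (rule SUP_least, rule ennreal_le_epsilon)
  fix f e assume f: "f \<in> below (\<Union>i. U i)" and e: "0 < (e::real)"
  let ?H = "{(\<lambda>x. \<Sum>i<n. h i x) | n h. \<forall>i. h i \<in> below (U i)}"
  have "\<exists>h\<in>?H. L f \<le> L h + e"
  proof (rule tau_smooth[OF belowD(1)[OF f] _ _ _ _ _ e])
    show "?H \<subseteq> bounded_continuous" using belowD(1) by (fastforce intro: C_sum)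
    have "\<forall>i. (\<lambda>x. 0) \<in> below (U i)" using zero_below by blast
    then show "?H \<noteq> {}" by auto
    show "0 \<le> h x" if "h \<in> ?H" for h x using that belowD(2) by (auto intro!: sum_nonneg)
  next
    fix h k assume "h \<in> ?H" "k \<in> ?H"
    then obtain m h' n k' where h: "h = (\<lambda>x. \<Sum>i<m. h' i x)" "\<And>i. h' i \<in> below (U i)"
      and k: "k = (\<lambda>x. \<Sum>i<n. k' i x)" "\<And>i. k' i \<in> below (U i)" by auto
    let ?l = "\<lambda>i x. max (h' i x) (k' i x)"
    have l: "?l i \<in> below (U i)" for i
      using belowD[OF h(2)] belowD[OF k(2)]
      by (intro belowI continuous_on_max bounded_continuous_continuous) (auto simp: le_max_iff_disj)
    have "h x \<le> (\<Sum>i<max m n. ?l i x)" for x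
      unfolding h(1) by (rule sum_le_included[where i = "\<lambda>i. i"])
        (auto simp: le_max_iff_disj belowD[OF h(2)])
    moreover have "k x \<le> (\<Sum>i<max m n. ?l i x)" for x
      unfolding k(1) by (rule sum_le_included[where i = "\<lambda>i. i"])
        (auto simp: le_max_iff_disj belowD[OF k(2)])
    moreover have "(\<lambda>x. \<Sum>i<max m n. ?l i x) \<in> ?H"
      by (intro CollectI exI[of _ "max m n"] exI[of _ ?l] conjI allI l refl)
    ultimately show "\<exists>l\<in>?H. \<forall>x. max (h x) (k x) \<le> l x"
      by (intro bexI[of _ "\<lambda>x. \<Sum>i<max m n. ?l i x"]) auto
  next
    fix x and d :: real assume d: "0 < d"
    show "\<exists>h\<in>?H. f x - d < h x"
    proof (cases "x \<in> (\<Union>i. U i)")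
      case False
      have "(\<lambda>x. \<Sum>i<(0::nat). (0::real)) \<in> ?H"
        by (intro CollectI exI[of _ 0] exI[of _ "\<lambda>i x. 0"] conjI allI zero_below) simp
      moreover have "f x = 0" using belowD(4)[OF f] False by blast
      ultimately show ?thesis using d by (intro bexI[of _ "\<lambda>x. \<Sum>i<(0::nat). (0::real)"]) auto
    next
      case True
      then obtain j where j: "x \<in> U j" by blast
      obtain g where g: "g \<in> below (U j)" "g x = 1" using urysohn_point[OF U j] .
      let ?h = "\<lambda>i. if i = j then g else (\<lambda>x. 0)"
      have "(\<lambda>x. \<Sum>i<Suc j. ?h i x) \<in> ?H"
        by (intro CollectI exI[of _ "Suc j"] exI[of _ ?h] conjI refl) (simp add: g(1) zero_below)
      moreover have "f x - d < (\<Sum>i<Suc j. ?h i x)"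
        using belowD(3)[OF f, of x] d g(2) by (simp add: sum.neutral)
      ultimately show ?thesis by (intro bexI[where x = "\<lambda>x. \<Sum>i<Suc j. ?h i x"])
    qed
  qed
  then obtain n h where h: "\<And>i. h i \<in> below (U i)" and le: "L f \<le> L (\<lambda>x. \<Sum>i<n. h i x) + e" by blast
  have pos: "0 \<le> L (h i)" for i using belowD[OF h] by (intro nonneg)
  have "ennreal (L f) \<le> ennreal ((\<Sum>i<n. L (h i)) + e)"
    using le L_sum[of "{..<n}" h] belowD(1)[OF h] by (intro ennreal_leI) simp
  also have "\<dots> = (\<Sum>i<n. ennreal (L (h i))) + ennreal e"
    using pos e by (simp add: sum_nonneg sum_ennreal)
  also have "\<dots> \<le> (\<Sum>i<n. content (U i)) + ennreal e"
    by (intro add_right_mono sum_mono content_upper h)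
  also have "\<dots> \<le> (\<Sum>i. content (U i)) + ennreal e"
    by (intro add_right_mono sum_le_suminf) auto
  finally show "ennreal (L f) \<le> (\<Sum>i. content (U i)) + ennreal e" .
qed

definition outer :: "'x set \<Rightarrow> ennreal" where
  "outer A = (INF U\<in>{U. open U \<and> A \<subseteq> U}. content U)"

lemma outer_lower: "open U \<Longrightarrow> A \<subseteq> U \<Longrightarrow> outer A \<le> content U"
  unfolding outer_def by (rule INF_lower) simp

lemma outer_open: "open U \<Longrightarrow> outer U = content U"
  by (rule antisym[OF outer_lower]) (auto simp: outer_def intro!: INF_greatest content_mono)

lemma outer_approx:
  assumes "0 < e"
  obtains U where "open U" "A \<subseteq> U" "content U \<le> outer A + ennreal e"
proof -
  have "outer A \<noteq> \<top>"
    using outer_lower[of UNIV A] content_UNIV by (auto simp: top_unique)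
  then have "outer A < outer A + ennreal e"
    using assms by (simp add: less_top ennreal_zero_less_divide)
  then have "\<exists>U\<in>{U. open U \<and> A \<subseteq> U}. content U < outer A + ennreal e"
    unfolding outer_def INF_less_iff[symmetric] by simp
  then show ?thesis using that by (auto intro: less_imp_le)
qed

lemma outer_measure_space_outer: "outer_measure_space (Pow UNIV) outer"
  unfolding outer_measure_space_def
proof (intro conjI)
  show "positive (Pow UNIV) outer"
    by (simp add: positive_def outer_open content_empty)
  show "increasing (Pow UNIV) outer"
    unfolding increasing_def outer_def by (auto intro!: INF_superset_mono)
  show "countably_subadditive (Pow UNIV) outer"
    unfolding countably_subadditive_def
  proof (intro allI impI, rule ennreal_le_epsilon)
    fix A :: "nat \<Rightarrow> 'x set" and e :: real assume e: "0 < e"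
    have "\<exists>U. open U \<and> A i \<subseteq> U \<and> content U \<le> outer (A i) + ennreal (e * (1 / 2) ^ Suc i)" for i
      using outer_approx[of "e * (1 / 2) ^ Suc i" "A i"] e by (metis mult_pos_pos zero_less_power half_gt_zero_iff zero_less_one)
    then obtain U where U: "\<And>i. open (U i)" "\<And>i. A i \<subseteq> U i"
      "\<And>i. content (U i) \<le> outer (A i) + ennreal (e * (1 / 2) ^ Suc i)" by metis
    have "outer (\<Union>i. A i) \<le> content (\<Union>i. U i)" using U(1,2) by (intro outer_lower) auto
    also have "\<dots> \<le> (\<Sum>i. content (U i))" by (rule content_countably_subadditive[OF U(1)])
    also have "\<dots> \<le> (\<Sum>i. outer (A i) + ennreal (e * (1 / 2) ^ Suc i))"
      by (intro suminf_le U(3)) auto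
    also have "\<dots> = (\<Sum>i. outer (A i)) + (\<Sum>i. ennreal (e * (1 / 2) ^ Suc i))"
      by (intro suminf_add[symmetric]) auto
    also have "(\<Sum>i. ennreal (e * (1 / 2) ^ Suc i)) = ennreal e"
      using sums_mult[OF power_half_series, of e] e by (intro suminf_ennreal_eq) auto
    finally show "outer (\<Union>i. A i) \<le> (\<Sum>i. outer (A i)) + ennreal e" .
  qed
qed

text \<open>
  Take \<open>f\<close> below \<open>V \<inter> U\<close> that nearly attains the content. It vanishes on \<open>V - U\<close>, hence the open
  set \<open>W\<close> where \<open>f\<close> is small covers \<open>V - U\<close>, and \<open>f + g\<close> exceeds 1 only slightly for \<open>g\<close> below \<open>W\<close>.
\<close>

lemma content_split:
  assumes U: "open U" and V: "open V"
  shows "content (V \<inter> U) + outer (V - U) \<le> content V"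
proof (rule ennreal_le_epsilon)
  fix e :: real assume e: "0 < e"
  have "0 < e / 3" using e by simp
  then obtain f where f: "f \<in> below (V \<inter> U)" and fle: "content (V \<inter> U) \<le> ennreal (L f) + ennreal (e / 3)"
    by (rule below_approx)
  define W where "W = V \<inter> {x. f x < e / 3}"
  have W: "open W" unfolding W_def
    using V belowD(1)[OF f]
    by (intro open_Int open_Collect_less continuous_intros bounded_continuous_continuous)
  obtain g where g: "g \<in> below W" and gle: "content W \<le> ennreal (L g) + ennreal (e / 3)"
    using \<open>0 < e / 3\<close> by (rule below_approx)
  have "V - U \<subseteq> W" using belowD(4)[OF f] e by (auto simp: W_def)
  then have gle': "outer (V - U) \<le> ennreal (L g) + ennreal (e / 3)"
    using outer_lower[OF W] gle by (meson order_trans)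
  define h where "h = (\<lambda>x. max 0 ((f x + g x) - e / 3))"
  have fgC: "f \<in> bounded_continuous" "g \<in> bounded_continuous" using belowD(1) f g by auto
  have hC: "h \<in> bounded_continuous" unfolding h_def
    by (intro bounded_continuous_max bounded_continuous_const C_diff C_add fgC)
  have h: "h \<in> below V"
  proof (rule belowI[OF bounded_continuous_continuous[OF hC]])
    fix x
    show "h x \<le> 1"
      using belowD(3)[OF f, of x] belowD(3)[OF g, of x] belowD(4)[OF g, of x] e
      by (cases "x \<in> W") (auto simp: h_def W_def)
    assume "x \<notin> V"
    then show "h x = 0" using belowD(4)[OF f, of x] belowD(4)[OF g, of x] e by (auto simp: h_def W_def)
  qed (simp add: h_def)
  have "L (\<lambda>x. (f x + g x) - e / 3) \<le> L h"
    by (rule L_mono[OF _ hC]) (auto simp: h_def intro!: C_diff C_add fgC bounded_continuous_const)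
  then have "L f + L g - e / 3 \<le> L h"
    using L_diff[OF C_add[OF fgC] bounded_continuous_const[of "e / 3"]] L_add[OF fgC]
    by (simp add: L_const)
  then have le: "L f + L g + 2 * (e / 3) \<le> L h + e" by simp
  have pos: "0 \<le> L f" "0 \<le> L g" "0 \<le> L h" using belowD[OF f] belowD[OF g] belowD[OF h] nonneg by auto
  have "content (V \<inter> U) + outer (V - U)
      \<le> (ennreal (L f) + ennreal (e / 3)) + (ennreal (L g) + ennreal (e / 3))"
    by (rule add_mono[OF fle gle'])
  also have "\<dots> = ennreal (L f + L g + 2 * (e / 3))"
    using pos e by (simp flip: ennreal_plus)
  also have "\<dots> \<le> ennreal (L h + e)" by (rule ennreal_leI[OF le])
  also have "\<dots> \<le> content V + ennreal e"
    using pos e content_upper[OF h] by (simp add: add_right_mono)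
  finally show "content (V \<inter> U) + outer (V - U) \<le> content V + ennreal e" .
qed

text \<open>
  Caratheodory's criterion for arbitrary sets follows from the one for open sets, since \<open>outer\<close> is
  defined by open covers.
\<close>

lemma open_in_lambda_system:
  assumes "open U"
  shows "U \<in> lambda_system UNIV (Pow UNIV) outer"
proof -
  interpret P: sigma_algebra UNIV "Pow UNIV :: 'x set set" by (rule sigma_algebra_Pow)
  have "outer (A \<inter> U) + outer (A - U) = outer A" for A
  proof (rule antisym)
    show "outer (A \<inter> U) + outer (A - U) \<le> outer A"
      unfolding outer_def[of A]
    proof (rule INF_greatest)
      fix V assume "V \<in> {V. open V \<and> A \<subseteq> V}"
      then have V: "open V" "A \<subseteq> V" by auto
      have "outer (A \<inter> U) \<le> content (V \<inter> U)" using V assms by (intro outer_lower) auto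
      moreover have "outer (A - U) \<le> outer (V - U)"
        unfolding outer_def using V by (intro INF_superset_mono) auto
      ultimately show "outer (A \<inter> U) + outer (A - U) \<le> content V"
        using content_split[OF assms V(1)] by (meson add_mono order_trans)
    qed
    have "outer A \<le> (\<Sum>i. outer (if i = 0 then A \<inter> U else if i = (1::nat) then A - U else {}))"
    proof -
      let ?B = "\<lambda>i. if i = 0 then A \<inter> U else if i = (1::nat) then A - U else {}"
      have "x \<in> (\<Union>i. ?B i)" if "x \<in> A" for x
        using that by (cases "x \<in> U") (auto intro: UN_I[of 0] UN_I[of 1])
      then have A: "(\<Union>i. ?B i) = A" by (auto split: if_splits)
      have "outer (\<Union>i. ?B i) \<le> (\<Sum>i. outer (?B i))"
      proof -
        have "disjoint_family ?B" by (auto simp: disjoint_family_on_def)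
        then show ?thesis
          using outer_measure_space_outer
          unfolding outer_measure_space_def countably_subadditive_def by blast
      qed
      then show ?thesis unfolding A .
    qed
    also have "\<dots> = (\<Sum>i\<in>{0, 1}. outer (if i = 0 then A \<inter> U else if i = (1::nat) then A - U else {}))"
      by (rule suminf_finite) (auto simp: outer_open content_empty)
    finally show "outer A \<le> outer (A \<inter> U) + outer (A - U)" by simp
  qed
  then show ?thesis unfolding P.lambda_system_eq by blast
qed

definition riesz_measure :: "'x measure" where
  "riesz_measure = measure_of UNIV (sets borel) outer"

lemma sets_riesz_measure [simp, measurable_cong]: "sets riesz_measure = sets borel"
  unfolding riesz_measure_def using sets.sigma_sets_eq[of "borel :: 'x measure"] by simp

lemma space_riesz_measure [simp]: "space riesz_measure = UNIV"
  by (simp add: riesz_measure_def space_measure_of_conv)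

lemma emeasure_riesz_measure_open: 
  assumes "open U"
  shows "emeasure riesz_measure U = content U"
proof -
  interpret P: sigma_algebra UNIV "Pow UNIV :: 'x set set" by (rule sigma_algebra_Pow)
  let ?\<Lambda> = "lambda_system UNIV (Pow UNIV) outer"
  have ms: "measure_space UNIV ?\<Lambda> outer" by (rule P.caratheodory_lemma[OF outer_measure_space_outer])
  then have "sigma_algebra UNIV ?\<Lambda>" by (simp add: measure_space_def)
  then have "sets (borel :: 'x measure) \<subseteq> ?\<Lambda>"
    unfolding sets_borel
    by (rule sigma_algebra.sigma_sets_subset) (use open_in_lambda_system in blast)
  moreover have "sigma_algebra UNIV (sets (borel :: 'x measure))"
    using sets.sigma_algebra_axioms[of "borel :: 'x measure"] by simp
  ultimately have "measure_space UNIV (sets (borel :: 'x measure)) outer"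
    using measure_down[OF ms] by blast
  then have "emeasure riesz_measure U = outer U"
    unfolding riesz_measure_def measure_space_def using assms
    by (intro emeasure_measure_of_sigma) auto
  then show ?thesis by (simp add: outer_open assms)
qed

lemma prob_space_riesz_measure: "prob_space riesz_measure"
  by (rule prob_spaceI) (simp add: emeasure_riesz_measure_open content_UNIV)

end

text \<open>
  The staircase with steps of height \<open>1 / n\<close> and \<open>n\<^sup>2\<close> levels approximates \<open>u\<close> from below; its
  integral involves only the measures of the open sets \<open>{u > k / n}\<close> when \<open>u\<close> is lower
  semicontinuous. The number of levels grows faster than \<open>n\<close>, so that infinite values are reached.
\<close>

lemma staircase_lower_bound:
  fixes n :: nat
  assumes "ennreal s < u"
    and "real n \<ge> s" "0 < n" "0 \<le> s"
  shows "ennreal (s - 1 / n) \<le> (\<Sum>k\<in>{1..n * n}. ennreal (1 / n) * indicator {y. ennreal (real k / real n) < y} u)"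
proof -
  define m where "m = nat \<lfloor>n * s\<rfloor>"
  have m: "real m \<le> n * s" "n * s < real m + 1" using assms(3,4) by (auto simp: m_def)
  have "n * s \<le> real (n * n)" using assms(2,3) by simp
  with m have "m \<le> n * n" by linarith
  have "s < (real m + 1) / n" using m(2) assms(3) by (simp add: pos_less_divide_eq mult.commute)
  then have "s - 1 / n \<le> m * (1 / n)" by (simp add: add_divide_distrib)
  then have "ennreal (s - 1 / n) \<le> ennreal (m * (1 / n))" by (rule ennreal_leI)
  also have "\<dots> = (\<Sum>k\<in>{1..m}. ennreal (1 / n))"
    by (simp add: ennreal_mult[symmetric] ennreal_of_nat_eq_real_of_nat)
  also have "\<dots> = (\<Sum>k\<in>{1..m}. ennreal (1 / n) * indicator {y. ennreal (real k / real n) < y} u)"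
  proof (rule sum.cong[OF refl])
    fix k assume "k \<in> {1..m}"
    then have "real k \<le> n * s" using m(1) by simp
    then have "real k / real n \<le> s" using assms(3) by (simp add: field_simps)
    then have "ennreal (real k / real n) < u" using assms(1) by (meson ennreal_leI le_less_trans)
    then show "ennreal (1 / n) = ennreal (1 / n) * indicator {y. ennreal (real k / real n) < y} u" by simp
  qed
  also have "\<dots> \<le> (\<Sum>k\<in>{1..n * n}. ennreal (1 / n) * indicator {y. ennreal (real k / real n) < y} u)"
    using \<open>m \<le> n * n\<close> by (intro sum_mono2) auto
  finally show ?thesis .
qed

lemma staircase_liminf:
  "u \<le> liminf (\<lambda>n. \<Sum>k\<in>{1..n * n}. ennreal (1 / n) * indicator {y. ennreal (real k / real n) < y} u)"
  unfolding le_Liminf_iff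
proof (intro allI impI)
  fix y assume "y < u"
  then obtain z where z: "y < z" "z < u" using dense by blast
  then have "y \<noteq> \<top>" "z \<noteq> \<top>" by auto
  then obtain q s where qs: "y = ennreal q" "0 \<le> q" "z = ennreal s" "0 \<le> s"
    by (metis ennreal_cases)
  then have "q < s" using z(1) by (simp add: ennreal_less_iff)
  obtain N :: nat where N: "max s (1 / (s - q)) < N" using reals_Archimedean2 by blast
  show "\<forall>\<^sub>F n in sequentially. y <
      (\<Sum>k\<in>{1..n * n}. ennreal (1 / n) * indicator {y. ennreal (real k / real n) < y} u)"
    using eventually_gt_at_top[of 0] eventually_ge_at_top[of N]
  proof eventually_elim
    case (elim n)
    have n: "max s (1 / (s - q)) < n" using N elim(2) by simp
    then have "1 < n * (s - q)" using \<open>q < s\<close> by (simp add: field_simps)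
    then have "q < s - 1 / n" using elim(1) by (simp add: field_simps)
    then have "y < ennreal (s - 1 / n)" using qs by (simp add: ennreal_less_iff)
    also have "\<dots> \<le> (\<Sum>k\<in>{1..n * n}. ennreal (1 / n) * indicator {y. ennreal (real k / real n) < y} u)"
      using z(2) qs n elim(1) by (intro staircase_lower_bound) auto
    finally show ?case .
  qed
qed

text \<open>
  The levels below \<open>u\<close> are among the first \<open>m\<close> ones, where \<open>m / n < u\<close>, and each contributes at most
  \<open>1 / n\<close>.
\<close>

lemma staircase_upper_bound:
  fixes f :: "nat \<Rightarrow> real"
  assumes "\<And>k. 0 \<le> f k" "\<And>k. f k \<le> (1::real)" "\<And>k. \<not> ennreal (real k / real n) < u \<Longrightarrow> f k = 0"
  shows "ennreal (\<Sum>k\<in>{1..N}. (1 / real n) * f k) \<le> u"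
proof -
  let ?J = "{k \<in> {1..N}. ennreal (real k / real n) < u}"
  have "(\<Sum>k\<in>{1..N}. (1 / real n) * f k) = (\<Sum>k\<in>?J. (1 / real n) * f k)"
    by (rule sum.mono_neutral_right) (use assms(3) in auto)
  also have "\<dots> \<le> (\<Sum>k\<in>?J. 1 / real n)"
    using assms(1,2) by (intro sum_mono) (simp add: divide_right_mono)
  also have "\<dots> = card ?J / n" by simp
  finally have le: "(\<Sum>k\<in>{1..N}. (1 / real n) * f k) \<le> card ?J / n" .
  show ?thesis
  proof (cases "?J = {}")
    case True
    then have "(\<Sum>k\<in>{1..N}. (1 / real n) * f k) \<le> 0" using le by (simp only: card.empty)
    then show ?thesis by (simp add: ennreal_neg)
  next
    case False
    then have M: "Max ?J \<in> ?J" by (intro Max_in) auto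
    have "card ?J \<le> card {1..Max ?J}" by (intro card_mono) auto
    then have "card ?J / n \<le> Max ?J / n" by (simp add: divide_right_mono)
    then have "ennreal (\<Sum>k\<in>{1..N}. (1 / real n) * f k) \<le> ennreal (Max ?J / n)"
      using le by (intro ennreal_leI) linarith
    also have "\<dots> < u" using M by blast
    finally show ?thesis by simp
  qed
qed

lemma lower_semicontinuous_measurable:
  assumes "lower_semicontinuous u"
  shows "u \<in> borel_measurable borel"
  by (rule borel_measurableI_greater) (use assms in \<open>auto simp: lower_semicontinuous_def\<close>)

lemma integral_le_of_nn_integral_le:
  assumes "integrable M f" "(\<integral>\<^sup>+x. ennreal (f x) \<partial>M) \<le> ennreal a" "0 \<le> a"
  shows "(\<integral>x. f x \<partial>M) \<le> a"
proof -
  have "ennreal (\<integral>x. max 0 (f x) \<partial>M) = (\<integral>\<^sup>+x. ennreal (max 0 (f x)) \<partial>M)"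
    by (rule nn_integral_eq_integral[symmetric]) (use assms(1) in auto)
  also have "\<dots> = (\<integral>\<^sup>+x. ennreal (f x) \<partial>M)"
    by (intro nn_integral_cong) (auto simp: max_def ennreal_neg)
  also have "\<dots> \<le> ennreal a" by (rule assms(2))
  finally have "(\<integral>x. max 0 (f x) \<partial>M) \<le> a" using assms(3) by simp
  moreover have "(\<integral>x. f x \<partial>M) \<le> (\<integral>x. max 0 (f x) \<partial>M)"
    by (rule integral_mono) (use assms(1) in auto)
  ultimately show ?thesis by simp
qed

context tight_functional
begin

text \<open>
  Replacing each level set \<open>{u > k / n}\<close> of the staircase by a function below it that nearly attains
  its content gives a bounded continuous \<open>h \<le> u\<close> with \<open>L h\<close> close to the integral of the staircase.
  Fatou's lemma passes to the limit.
\<close>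

lemma nn_integral_riesz_measure_le:
  assumes u: "lower_semicontinuous u"
    and le: "\<And>h. h \<in> bounded_continuous \<Longrightarrow> (\<And>x. 0 \<le> h x) \<Longrightarrow> (\<And>x. ennreal (h x) \<le> u x) \<Longrightarrow> L h \<le> c"
    and c: "0 \<le> c"
  shows "(\<integral>\<^sup>+x. u x \<partial>riesz_measure) \<le> ennreal c"
proof -
  define U where "U n k = {x. ennreal (real k / real n) < u x}" for n k :: nat
  have U: "open (U n k)" for n k using u by (auto simp: U_def lower_semicontinuous_def)
  have [measurable]: "U n k \<in> sets borel" for n k using U by auto
  define S where "S n x = (\<Sum>k\<in>{1..n * n}. ennreal (1 / real n) * indicator (U n k) x)" for n :: nat and x
  have [measurable]: "S n \<in> borel_measurable borel" for n unfolding S_def by measurable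
  have S: "(\<integral>\<^sup>+x. S n x \<partial>riesz_measure) \<le> ennreal c" for n
  proof (cases "n = 0")
    case False
    show ?thesis
    proof (rule ennreal_le_epsilon)
      fix e :: real assume e: "0 < e"
      then have "0 < e / n" using False by simp
      then have "\<exists>f. f \<in> below (U n k) \<and> content (U n k) \<le> ennreal (L f) + ennreal (e / n)" for k
        using below_approx by metis
      then obtain f where f: "\<And>k. f k \<in> below (U n k)"
        "\<And>k. content (U n k) \<le> ennreal (L (f k)) + ennreal (e / n)" by metis
      let ?h = "\<lambda>x. \<Sum>k\<in>{1..n * n}. (1 / real n) * f k x"
      have pos: "0 \<le> L (f k)" for k using belowD[OF f(1)] by (intro nonneg)
      have fC: "(\<lambda>x. (1 / real n) * f k x) \<in> bounded_continuous" for k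
        by (rule C_scale[OF belowD(1)[OF f(1)]])
      have Lh: "L ?h = (\<Sum>k\<in>{1..n * n}. (1 / real n) * L (f k))"
        using L_sum[of "{1..n * n}" "\<lambda>k x. (1 / real n) * f k x"] fC
          L_scale[OF belowD(1)[OF f(1)], of "1 / real n"] by simp
      have "L ?h \<le> c"
      proof (rule le)
        show "?h \<in> bounded_continuous" by (rule C_sum[OF fC])
        show "0 \<le> ?h x" for x using belowD(2)[OF f(1)] by (simp add: sum_nonneg)
        show "ennreal (?h x) \<le> u x" for x
          by (rule staircase_upper_bound) (use belowD(2,3,4)[OF f(1), where x = x] in \<open>auto simp: U_def\<close>)
      qed
      have "(\<integral>\<^sup>+x. S n x \<partial>riesz_measure)
          = (\<Sum>k\<in>{1..n * n}. ennreal (1 / real n) * content (U n k))"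
        unfolding S_def
        by (subst nn_integral_sum)
          (simp_all add: nn_integral_cmult_indicator emeasure_riesz_measure_open[OF U])
      also have "\<dots> \<le> (\<Sum>k\<in>{1..n * n}. ennreal (1 / real n) * (ennreal (L (f k)) + ennreal (e / n)))"
        by (intro sum_mono mult_left_mono f(2)) auto
      also have "\<dots> = ennreal (\<Sum>k\<in>{1..n * n}. (1 / real n) * (L (f k) + e / n))"
        using pos e by (simp add: ennreal_mult'[symmetric] ennreal_plus[symmetric] sum_ennreal del: ennreal_plus)
      also have "(\<Sum>k\<in>{1..n * n}. (1 / real n) * (L (f k) + e / n)) = L ?h + e"
        unfolding Lh using False by (simp add: distrib_left sum.distrib add_divide_distrib)
      also have "ennreal (L ?h + e) \<le> ennreal (c + e)" using \<open>L ?h \<le> c\<close> by (intro ennreal_leI) simp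
      also have "\<dots> = ennreal c + ennreal e" using c e by simp
      finally show "(\<integral>\<^sup>+x. S n x \<partial>riesz_measure) \<le> ennreal c + ennreal e" .
    qed
  qed (simp add: S_def)
  have "(\<integral>\<^sup>+x. u x \<partial>riesz_measure) \<le> (\<integral>\<^sup>+x. liminf (\<lambda>n. S n x) \<partial>riesz_measure)"
  proof (rule nn_integral_mono)
    show "u x \<le> liminf (\<lambda>n. S n x)" for x
      using staircase_liminf[of "u x"] by (simp add: S_def U_def indicator_def)
  qed
  also have "\<dots> \<le> liminf (\<lambda>n. \<integral>\<^sup>+x. S n x \<partial>riesz_measure)"
    by (rule nn_integral_liminf) measurable
  also have "\<dots> \<le> ennreal c"
    by (rule Liminf_le) (use S in auto)
  finally show ?thesis .
qed

text \<open>
  A bounded continuous function is lower semicontinuous after adding a constant that makes it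
  nonnegative, so the previous lemma gives one inequality. The other one is the same for \<open>- f\<close>; it
  uses that both the measure and \<open>L\<close> are normalised.
\<close>

lemma
  assumes f: "f \<in> bounded_continuous"
  shows integrable_riesz_measure: "integrable riesz_measure f"
    and integral_riesz_measure: "(\<integral>x. f x \<partial>riesz_measure) = L f"
proof -
  interpret prob_space riesz_measure by (rule prob_space_riesz_measure)
  have integrable: "integrable riesz_measure f" if f: "f \<in> bounded_continuous" for f
  proof -
    obtain M where "\<And>x. \<bar>f x\<bar> \<le> M" using bounded_continuous_bound[OF f] by blast
    moreover have "f \<in> borel_measurable borel"
      using f by (intro borel_measurable_continuous_onI bounded_continuous_continuous)
    ultimately show ?thesis by (intro integrable_const_bound[of _ M]) auto
  qed
  have le: "(\<integral>x. f x \<partial>riesz_measure) \<le> L f" if f: "f \<in> bounded_continuous" for f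
  proof -
    obtain M where M: "\<And>x. \<bar>f x\<bar> \<le> M" using bounded_continuous_bound[OF f] by blast
    have fM: "(\<lambda>x. f x + M) \<in> bounded_continuous" by (intro C_add f bounded_continuous_const)
    have pos: "0 \<le> f x + M" for x using M[of x] by linarith
    have "(\<integral>x. f x + M \<partial>riesz_measure) \<le> L (\<lambda>x. f x + M)"
    proof (rule integral_le_of_nn_integral_le[OF integrable[OF fM]])
      show "0 \<le> L (\<lambda>x. f x + M)" by (rule nonneg[OF fM pos])
      show "(\<integral>\<^sup>+x. ennreal (f x + M) \<partial>riesz_measure) \<le> ennreal (L (\<lambda>x. f x + M))"
      proof (rule nn_integral_riesz_measure_le)
        have "continuous_on UNIV (\<lambda>x. ennreal (f x + M))"
          using bounded_continuous_continuous[OF fM] by (intro continuous_on_ennreal)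
        then show "lower_semicontinuous (\<lambda>x. ennreal (f x + M))"
          unfolding lower_semicontinuous_def
          by (intro allI open_Collect_less continuous_on_const)
        show "L h \<le> L (\<lambda>x. f x + M)"
          if "h \<in> bounded_continuous" "\<And>x. ennreal (h x) \<le> ennreal (f x + M)" for h
          using that pos by (intro L_mono[OF _ fM]) (auto simp: ennreal_le_iff)
        show "0 \<le> L (\<lambda>x. f x + M)" by (rule nonneg[OF fM pos])
      qed
    qed
    then show ?thesis
      using integrable[OF f] L_add[OF f bounded_continuous_const[of M]]
      by (simp add: L_const prob_space[unfolded space_riesz_measure])
  qed
  have "(\<lambda>x. - f x) \<in> bounded_continuous"
    using function_space_minus[OF function_space_bounded_continuous f] .
  from le[OF this] le[OF f] show "(\<integral>x. f x \<partial>riesz_measure) = L f"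
    using L_minus[OF f] by simp
  show "integrable riesz_measure f" by (rule integrable[OF f])
qed

text \<open>
  Composition with the homeomorphism carries the functions below \<open>U\<close> to those below its preimage
  and does not change the values of \<open>L\<close>. So the measure and its image agree on open sets, which are an intersection stable generator.
\<close>

lemma distr_riesz_measure:
  assumes cont: "continuous_on UNIV \<theta>" "continuous_on UNIV \<eta>"
    and inverse: "\<And>x. \<theta> (\<eta> x) = x" "\<And>x. \<eta> (\<theta> x) = x"
    and inv: "\<And>f. f \<in> bounded_continuous \<Longrightarrow> L (f \<circ> \<theta>) = L f"
  shows "distr riesz_measure borel \<theta> = riesz_measure"
proof -
  interpret prob_space riesz_measure by (rule prob_space_riesz_measure)
  have [measurable]: "\<theta> \<in> measurable borel borel"
    using cont(1) by (rule borel_measurable_continuous_onI)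
  have pull: "f \<circ> \<theta> \<in> below (\<theta> -` U)" if "f \<in> below U" "continuous_on UNIV \<theta>" for f U \<theta>
    using belowD(2,3,4)[OF that(1)] bounded_continuous_continuous[OF belowD(1)[OF that(1)]] that(2)
    by (intro belowI continuous_on_compose) (auto intro: continuous_on_subset)
  have invariant: "content (\<theta> -` U) = content U" for U
  proof (rule antisym)
    show "content U \<le> content (\<theta> -` U)"
      unfolding content_def[of U]
    proof (rule SUP_least)
      fix f assume "f \<in> below U"
      then show "ennreal (L f) \<le> content (\<theta> -` U)"
        using content_upper[OF pull[OF _ cont(1)]] inv[OF belowD(1)] by fastforce
    qed
    show "content (\<theta> -` U) \<le> content U"
      unfolding content_def[of "\<theta> -` U"]
    proof (rule SUP_least)
      fix f assume f: "f \<in> below (\<theta> -` U)"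
      have "\<eta> -` \<theta> -` U = U" using inverse(1) by auto
      then have f': "f \<circ> \<eta> \<in> below U" using pull[OF f cont(2)] by simp
      have "f \<circ> \<eta> \<circ> \<theta> = f" using inverse(2) by (simp add: fun_eq_iff)
      then show "ennreal (L f) \<le> content U"
        using content_upper[OF f'] inv[OF belowD(1)[OF f']] by simp
    qed
  qed
  show ?thesis
  proof (rule measure_eqI_generator_eq[where E = "{U. open U}" and \<Omega> = UNIV and A = "\<lambda>_. UNIV"])
    show "Int_stable {U :: 'x set. open U}" by (auto simp: Int_stable_def)
    show "emeasure (distr riesz_measure borel \<theta>) U = emeasure riesz_measure U"
      if "U \<in> {U. open U}" for U
    proof -
      have "open (\<theta> -` U)" using cont(1) that by (auto intro: open_vimage)
      then show ?thesis
        using that by (simp add: emeasure_distr emeasure_riesz_measure_open invariant)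
    qed
      have "prob_space (distr riesz_measure borel \<theta>)" by (rule prob_space_distr) measurable
    then show "emeasure (distr riesz_measure borel \<theta>) UNIV \<noteq> \<infinity>"
      using prob_space.emeasure_space_1 by fastforce
  qed (auto simp: sets_borel)
qed

end

section \<open>Realisation of dominated functionals\<close>

lemma ennreal_plus_le: "ennreal (a + b) \<le> ennreal a + ennreal b"
proof -
  have "ennreal (a + b) \<le> ennreal (max 0 a + max 0 b)" by (intro ennreal_leI) simp
  also have "\<dots> = ennreal a + ennreal b" by (simp add: ennreal_plus)
  finally show ?thesis .
qed

lemma ereal_le_enn2ereal_iff: "ereal a \<le> enn2ereal c \<longleftrightarrow> ennreal a \<le> c"
proof (cases "0 \<le> a")
  case True
  then show ?thesis by (simp add: less_eq_ennreal.rep_eq enn2ereal_ennreal)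
next
  case False
  then have "ereal a \<le> 0" by simp
  then have "ereal a \<le> enn2ereal c" using enn2ereal_nonneg order_trans by blast
  then show ?thesis using False by (simp add: ennreal_neg)
qed

text \<open>
  A regular function, although possibly unbounded, is a bounded continuous one up to a small
  multiple of the modulus. It is bounded by some \<open>c\<close> on the closure of the sublevel set given by
  \<open>2 u / e\<close>, as this closure is compact. Truncate it at \<open>c\<close> and extend the truncation continuously
  from the larger compact set given by \<open>2 w / e\<close>, where \<open>w\<close> dominates both \<open>u\<close> and \<open>c\<close>. Outside of
  the smaller set the truncation error is at most \<open>u\<close>, and outside of the larger one the total
  error is at most \<open>2 w\<close>; there these functions are dominated by multiples of the modulus.
\<close>

lemma regular_approximation:
  fixes chi :: "'x::topological_space \<Rightarrow> ennreal"
  assumes cr: "completely_regular_space (euclidean :: 'x topology)"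
    and G: "function_space G" "\<And>c. (\<lambda>x. c) \<in> G"
    and dir: "\<And>g1 g2. g1 \<in> G \<Longrightarrow> g2 \<in> G \<Longrightarrow> \<exists>g\<in>G. \<forall>x. max (g1 x) (g2 x) \<le> g x"
    and mod: "regularity_modulus G chi"
    and reg: "chi_regular G chi v"
    and v: "u \<in> G" "\<And>x. \<bar>v x\<bar> \<le> u x"
    and e: "0 < e"
  shows "\<exists>h\<in>bounded_continuous. \<forall>x. ennreal \<bar>v x - h x\<bar> \<le> ennreal e * chi x"
proof -
  define H where "H w = closure (sublevel chi (\<lambda>x. (2 / e) * w x))" for w
  have H: "compact (H w)" "continuous_on (H w) v" if "w \<in> G" for w
    using mod reg function_space_scale[OF G(1) that, of "2 / e"]
    by (auto simp: H_def regularity_modulus_def chi_regular_def)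
  have outside: "ennreal (w x) \<le> ennreal (e / 2) * chi x" if "x \<notin> H w" for w x
  proof -
    have "x \<notin> sublevel chi (\<lambda>x. (2 / e) * w x)"
      using that closure_subset by (auto simp: H_def)
    then have "ennreal ((2 / e) * w x) \<le> chi x"
      by (simp add: sublevel_def flip: ereal_le_enn2ereal_iff)
    then have "ennreal (e / 2) * ennreal ((2 / e) * w x) \<le> ennreal (e / 2) * chi x"
      by (intro mult_left_mono) auto
    then show ?thesis using e by (simp add: ennreal_mult'[symmetric])
  qed
  have "compact (v ` H u)" using H[OF v(1)] by (intro compact_continuous_image)
  then obtain C where "\<And>y. y \<in> v ` H u \<Longrightarrow> \<bar>y\<bar> \<le> C"
    using compact_imp_bounded bounded_real by metis
  then have C: "\<bar>v x\<bar> \<le> max 0 C" if "x \<in> H u" for x using that by fastforce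
  define c where "c = max 0 C"
  obtain w where w: "w \<in> G" "\<And>x. max (u x) c \<le> w x" using dir[OF v(1) G(2)[of c]] by auto
  define t where "t = (\<lambda>x. max (- c) (min c (v x)))"
  have cont: "continuous_map (subtopology euclidean (H w)) euclidean t"
    unfolding t_def using H(2)[OF w(1)] by (auto intro!: continuous_intros)
  have "is_interval {- c..c}" "{- c..c} \<noteq> {}" "t ` H w \<subseteq> {- c..c}" "compactin euclidean (H w)"
    using H(1)[OF w(1)] by (auto simp: t_def c_def is_interval_cc)
  from Tietze_extension_completely_regular[OF cr this(4,1,2) cont this(3)]
  obtain h where h: "continuous_map euclidean euclideanreal h" "h ` topspace euclidean \<subseteq> {- c..c}"
    "\<And>x. x \<in> H w \<Longrightarrow> h x = t x" by metis
  have hb: "\<bar>h x\<bar> \<le> c" for x using h(2) by (auto simp: image_subset_iff abs_le_iff minus_le_iff)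
  show ?thesis
  proof (intro bexI[of _ h] allI)
    show "h \<in> bounded_continuous" using h(1) hb by (intro bounded_continuousI) auto
    show "ennreal \<bar>v x - h x\<bar> \<le> ennreal e * chi x" for x
    proof -
      consider "x \<in> H w" "x \<in> H u" | "x \<in> H w" "x \<notin> H u" | "x \<notin> H w" by blast
      then show ?thesis
      proof cases
        case 1
        then have "h x = v x" using h(3) C by (force simp: t_def c_def)
        then show ?thesis by simp
      next
        case 2
        then have "\<bar>v x - h x\<bar> \<le> u x" using h(3) v(2)[of x] by (simp add: t_def c_def)
        then have "ennreal \<bar>v x - h x\<bar> \<le> ennreal (u x)" by (rule ennreal_leI)
        also have "\<dots> \<le> ennreal (e / 2) * chi x" by (rule outside[OF 2(2)])
        also have "\<dots> \<le> ennreal e * chi x" using e by (intro mult_right_mono ennreal_leI) auto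
        finally show ?thesis .
      next
        case 3
        have "\<bar>v x - h x\<bar> \<le> 2 * w x" using v(2)[of x] hb[of x] w(2)[of x] by linarith
        then have "ennreal \<bar>v x - h x\<bar> \<le> ennreal (2 * w x)" by (rule ennreal_leI)
        also have "\<dots> = 2 * ennreal (w x)" by (simp add: ennreal_mult')
        also have "\<dots> \<le> 2 * (ennreal (e / 2) * chi x)" by (intro mult_left_mono outside[OF 3]) auto
        also have "\<dots> = ennreal (2 * (e / 2)) * chi x"
          by (subst ennreal_mult') (simp_all add: mult.assoc)
        finally show ?thesis by simp
      qed
    qed
  qed
qed

definition invariant_realisation ::
  "('x::topological_space \<Rightarrow> 'x) set \<Rightarrow> ('x \<Rightarrow> real) set \<Rightarrow> ('x \<Rightarrow> ennreal) \<Rightarrow> (('x \<Rightarrow> real) \<Rightarrow> real) \<Rightarrow> real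
     \<Rightarrow> 'x measure \<Rightarrow> bool" where
  "invariant_realisation \<Theta> G chi \<Phi> r \<mu> \<longleftrightarrow>
     prob_space \<mu> \<and> sets \<mu> = sets borel \<and> (\<forall>\<theta>\<in>\<Theta>. distr \<mu> borel \<theta> = \<mu>) \<and>
     (\<forall>g\<in>G. integrable \<mu> g \<and> (\<integral>x. g x \<partial>\<mu>) = \<Phi> g) \<and> (\<integral>\<^sup>+x. chi x \<partial>\<mu>) \<le> ennreal r"

text \<open>
  The common core of both cases. The relation \<open>cost\<close> lists functions \<open>\<psi>\<close> with an upper bound for
  their integral that the measure to be found shall respect: a convex cone, stable under \<open>\<Theta>\<close>, that
  contains \<open>(r, chi)\<close> and is consistent with \<open>\<Phi>\<close> in the sense of the last hypothesis.

  The functional is extended from \<open>G\<close> to the space \<open>F\<close> of all functions dominated by \<open>G\<close>, subject to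
  \<open>L v \<le> \<Phi> g + a\<close> whenever \<open>v \<le> g + \<psi>\<close> and \<open>\<psi>\<close> has cost \<open>a\<close>. With \<open>\<psi> = 0\<close> this forces \<open>L\<close> to be
  positive and to extend \<open>\<Phi>\<close>; with \<open>\<psi> = e * chi\<close> it bounds \<open>L v\<close> by \<open>e * r\<close> for \<open>v \<le> e * chi\<close>, which gives
  tightness, the bound on the integral of \<open>chi\<close>, and the passage from bounded continuous
  functions to the elements of \<open>G\<close>. The modulus itself may be infinite and never enters \<open>F\<close>. The
  inequality \<open>v \<le> g + \<psi>\<close> is written as \<open>ennreal (v x - g x) \<le> \<psi> x\<close>; the truncation of negative values
  is harmless since \<open>\<psi> \<ge> 0\<close>.
\<close>

theorem realisation_of_dominated_functional:
  fixes \<Theta> :: "('x::topological_space \<Rightarrow> 'x) set"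
    and cost :: "real \<Rightarrow> ('x \<Rightarrow> ennreal) \<Rightarrow> bool"
  assumes cr: "completely_regular_space (euclidean :: 'x topology)"
    and comm: "\<And>\<theta> \<eta>. \<theta> \<in> \<Theta> \<Longrightarrow> \<eta> \<in> \<Theta> \<Longrightarrow> \<theta> \<circ> \<eta> = \<eta> \<circ> \<theta>"
    and cont: "\<And>\<theta>. \<theta> \<in> \<Theta> \<Longrightarrow> continuous_on UNIV \<theta>"
    and inverse: "\<And>\<theta>. \<theta> \<in> \<Theta> \<Longrightarrow> \<exists>\<eta>\<in>\<Theta>. \<theta> \<circ> \<eta> = id"
    and G: "function_space G" "\<And>c. (\<lambda>x. c) \<in> G"
    and dir: "\<And>g1 g2. g1 \<in> G \<Longrightarrow> g2 \<in> G \<Longrightarrow> \<exists>g\<in>G. \<forall>x. max (g1 x) (g2 x) \<le> g x"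
    and modulus: "regularity_modulus G chi"
    and reg: "\<And>g. g \<in> G \<Longrightarrow> chi_regular G chi g"
    and lin: "linear_functional_on G \<Phi>" and inv: "invariant_functional \<Theta> G \<Phi>"
    and one: "\<Phi> (\<lambda>x. 1) = 1" and r: "0 \<le> r"
    and cost_add: "\<And>a \<psi> b \<phi>. cost a \<psi> \<Longrightarrow> cost b \<phi> \<Longrightarrow> cost (a + b) (\<lambda>x. \<psi> x + \<phi> x)"
    and cost_scale: "\<And>c a \<psi>. 0 \<le> c \<Longrightarrow> cost a \<psi> \<Longrightarrow> cost (c * a) (\<lambda>x. ennreal c * \<psi> x)"
    and cost_inv: "\<And>\<theta> a \<psi>. \<theta> \<in> \<Theta> \<Longrightarrow> cost a \<psi> \<Longrightarrow> cost a (\<psi> \<circ> \<theta>)"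
    and cost_chi: "cost r chi"
    and cost_bound: "\<And>g a \<psi>. g \<in> G \<Longrightarrow> cost a \<psi> \<Longrightarrow> (\<And>x. ennreal (g x) \<le> \<psi> x) \<Longrightarrow> \<Phi> g \<le> a"
  shows "\<exists>\<mu>. invariant_realisation \<Theta> G chi \<Phi> r \<mu>"
proof -
  define F where "F = {v. \<exists>g\<in>G. \<forall>x. \<bar>v x\<bar> \<le> g x}"
  have FI: "v \<in> F" if "g \<in> G" "\<And>x. \<bar>v x\<bar> \<le> g x" for v g using that by (auto simp: F_def)
  have invG: "g \<circ> \<theta> \<in> G" "\<Phi> (g \<circ> \<theta>) = \<Phi> g" if "\<theta> \<in> \<Theta>" "g \<in> G" for \<theta> g
    using inv that by (auto simp: invariant_functional_def)
  note Gadd = function_space_add[OF G(1)] and Gscale = function_space_scale[OF G(1)]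
    and Gminus = function_space_minus[OF G(1)]
  note \<Phi>add = linear_functional_on_add[OF lin] and \<Phi>scale = linear_functional_on_scale[OF lin]
    and \<Phi>minus = linear_functional_on_minus[OF lin]
  have \<Phi>zero: "\<Phi> (\<lambda>x. 0) = 0" by (rule linear_functional_on_zero[OF lin G(1)])
  have cost0: "cost 0 (\<lambda>x. 0)" using cost_scale[OF _ cost_chi, of 0] by simp
  have F: "function_space F"
    unfolding function_space_def
  proof (intro conjI ballI allI)
    show "(\<lambda>x. 0) \<in> F" by (rule FI[OF G(2)[of 0]]) simp
  next
    fix v w assume "v \<in> F" "w \<in> F"
    then obtain g h where gh: "g \<in> G" "\<And>x. \<bar>v x\<bar> \<le> g x" "h \<in> G" "\<And>x. \<bar>w x\<bar> \<le> h x"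
      by (auto simp: F_def)
    show "(\<lambda>x. v x + w x) \<in> F"
    proof (rule FI[OF Gadd[OF gh(1,3)]])
      show "\<bar>v x + w x\<bar> \<le> g x + h x" for x using gh(2)[of x] gh(4)[of x] by linarith
    qed
  next
    fix c v assume "v \<in> F"
    then obtain g where g: "g \<in> G" "\<And>x. \<bar>v x\<bar> \<le> g x" by (auto simp: F_def)
    show "(\<lambda>x. c * v x) \<in> F"
      by (rule FI[OF Gscale[OF g(1), of "\<bar>c\<bar>"]]) (simp add: abs_mult mult_left_mono g(2))
  qed
  have Finv: "invariant_space \<Theta> F"
    unfolding invariant_space_def
  proof (intro ballI)
    fix \<theta> v assume \<theta>: "\<theta> \<in> \<Theta>" and "v \<in> F"
    then obtain g where g: "g \<in> G" "\<And>x. \<bar>v x\<bar> \<le> g x" by (auto simp: F_def)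
    show "v \<circ> \<theta> \<in> F" by (rule FI[OF invG(1)[OF \<theta> g(1)]]) (simp add: g(2))
  qed
  have GF: "g \<in> F" if g: "g \<in> G" for g
  proof -
    obtain h where h: "h \<in> G" "\<And>x. max (g x) (- g x) \<le> h x" using dir[OF g Gminus[OF g]] by auto
    show ?thesis by (rule FI[OF h(1)]) (use h(2) in \<open>auto simp: abs_le_iff\<close>)
  qed
  have CF: "f \<in> F" if f: "f \<in> bounded_continuous" for f
  proof -
    obtain M where "\<And>x. \<bar>f x\<bar> \<le> M" using bounded_continuous_bound[OF f] by blast
    then show ?thesis using FI[OF G(2)[of M]] by blast
  qed
  define K where "K = {(v, a). v \<in> F \<and>
    (\<exists>g\<in>G. \<exists>\<psi> b. cost b \<psi> \<and> a = \<Phi> g + b \<and> (\<forall>x. ennreal (v x - g x) \<le> \<psi> x))}"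
  have KI: "(v, a) \<in> K" if "v \<in> F" "g \<in> G" "cost b \<psi>" "a = \<Phi> g + b" "\<And>x. ennreal (v x - g x) \<le> \<psi> x"
    for v a g b \<psi> using that unfolding K_def by blast
  have KE: "\<exists>g \<psi> b. v \<in> F \<and> g \<in> G \<and> cost b \<psi> \<and> a = \<Phi> g + b \<and> (\<forall>x. ennreal (v x - g x) \<le> \<psi> x)"
    if "(v, a) \<in> K" for v a using that unfolding K_def by blast
  have Kdom: "(v, \<Phi> g) \<in> K" if "v \<in> F" "g \<in> G" "\<And>x. v x \<le> g x" for v g
    by (rule KI[OF that(1,2) cost0]) (use that(3) in \<open>auto simp: ennreal_neg\<close>)
  have "dominating_cone \<Theta> F K"
    unfolding dominating_cone_def
  proof (intro conjI allI impI ballI)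
    show "K \<subseteq> F \<times> UNIV" by (auto simp: K_def)
  next
    fix v assume v: "v \<in> F"
    then obtain g where g: "g \<in> G" "\<And>x. \<bar>v x\<bar> \<le> g x" by (auto simp: F_def)
    have "(v, \<Phi> g) \<in> K" by (rule Kdom[OF v g(1)]) (use g(2) abs_le_D1 in blast)
    then show "\<exists>a. (v, a) \<in> K" ..
  next
    fix v a w b assume "(v, a) \<in> K" "(w, b) \<in> K"
    then obtain g \<psi> a' h \<phi> b' where
      v: "v \<in> F" "g \<in> G" "cost a' \<psi>" "a = \<Phi> g + a'" "\<And>x. ennreal (v x - g x) \<le> \<psi> x"
      and w: "w \<in> F" "h \<in> G" "cost b' \<phi>" "b = \<Phi> h + b'" "\<And>x. ennreal (w x - h x) \<le> \<phi> x"
      using KE by meson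
    show "((\<lambda>x. v x + w x), a + b) \<in> K"
    proof (rule KI[OF function_space_add[OF F v(1) w(1)] Gadd[OF v(2) w(2)] cost_add[OF v(3) w(3)]])
      show "a + b = \<Phi> (\<lambda>x. g x + h x) + (a' + b')" by (simp add: v(4) w(4) \<Phi>add[OF v(2) w(2)])
      fix x
      have "ennreal ((v x + w x) - (g x + h x)) \<le> ennreal (v x - g x) + ennreal (w x - h x)"
        using ennreal_plus_le[of "v x - g x" "w x - h x"] by (simp add: algebra_simps)
      also have "\<dots> \<le> \<psi> x + \<phi> x" by (intro add_mono v(5) w(5))
      finally show "ennreal ((v x + w x) - (g x + h x)) \<le> \<psi> x + \<phi> x" .
    qed
  next
    fix c :: real and v a assume c: "0 < c" and "(v, a) \<in> K"
    then obtain g \<psi> b where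
      v: "v \<in> F" "g \<in> G" "cost b \<psi>" "a = \<Phi> g + b" "\<And>x. ennreal (v x - g x) \<le> \<psi> x"
      using KE by meson
    have "0 \<le> c" using c by simp
    show "((\<lambda>x. c * v x), c * a) \<in> K"
    proof (rule KI[OF function_space_scale[OF F v(1)] Gscale[OF v(2)] cost_scale[OF \<open>0 \<le> c\<close> v(3)]])
      show "c * a = \<Phi> (\<lambda>x. c * g x) + c * b" by (simp add: v(4) \<Phi>scale[OF v(2)] distrib_left)
      show "ennreal (c * v x - c * g x) \<le> ennreal c * \<psi> x" for x
        using mult_left_mono[OF v(5)[of x], of "ennreal c"] \<open>0 \<le> c\<close>
        by (simp add: ennreal_mult'[symmetric] right_diff_distrib)
    qed
  next
    fix \<theta> v a assume \<theta>: "\<theta> \<in> \<Theta>" and "(v, a) \<in> K"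
    then obtain g \<psi> b where
      v: "v \<in> F" "g \<in> G" "cost b \<psi>" "a = \<Phi> g + b" "\<And>x. ennreal (v x - g x) \<le> \<psi> x"
      using KE by meson
    have "v \<circ> \<theta> \<in> F" using Finv \<theta> v(1) by (simp add: invariant_space_def)
    then show "(v \<circ> \<theta>, a) \<in> K"
      by (rule KI[OF _ invG(1)[OF \<theta> v(2)] cost_inv[OF \<theta> v(3)]])
        (use v(4,5) invG(2)[OF \<theta> v(2)] in auto)
  next
    fix a assume "((\<lambda>x. 0), a) \<in> K"
    then obtain g \<psi> b where
      v: "g \<in> G" "cost b \<psi>" "a = \<Phi> g + b" "\<And>x. ennreal (0 - g x) \<le> \<psi> x"
      using KE by meson
    have "\<Phi> (\<lambda>x. - g x) \<le> b" by (rule cost_bound[OF Gminus[OF v(1)] v(2)]) (use v(4) in simp)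
    then show "0 \<le> a" using \<Phi>minus[OF v(1)] v(3) by simp
  qed
  from dominating_cone_invariant_functional[OF F Finv comm this]
  obtain L where L: "linear_functional_on F L" "invariant_functional \<Theta> F L"
    and LK: "\<And>v a. (v, a) \<in> K \<Longrightarrow> L v \<le> a" by metis
  have Ldom: "L v \<le> \<Phi> g" if "v \<in> F" "g \<in> G" "\<And>x. v x \<le> g x" for v g
    by (rule LK[OF Kdom[OF that]])
  have Lchi: "L v \<le> e * r" if "v \<in> F" "0 \<le> e" "\<And>x. ennreal (v x) \<le> ennreal e * chi x" for v e
    by (rule LK, rule KI[OF that(1) G(2)[of 0] cost_scale[OF that(2) cost_chi]])
      (use that(3) \<Phi>zero in auto)
  have L\<Phi>: "L g = \<Phi> g" if g: "g \<in> G" for g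
  proof (rule antisym)
    show "L g \<le> \<Phi> g" by (rule Ldom[OF GF[OF g] g]) simp
    have "L (\<lambda>x. - g x) \<le> \<Phi> (\<lambda>x. - g x)" by (rule Ldom[OF GF[OF Gminus[OF g]] Gminus[OF g]]) simp
    then show "\<Phi> g \<le> L g"
      using \<Phi>minus[OF g] linear_functional_on_minus[OF L(1) GF[OF g]] by simp
  qed
  have Lnonneg: "0 \<le> L v" if "v \<in> F" "\<And>x. 0 \<le> v x" for v
    using Ldom[OF function_space_minus[OF F that(1)] G(2)[of 0]] that(2) \<Phi>zero
      linear_functional_on_minus[OF L(1) that(1)] by simp
  have Lapprox: "\<bar>L v - L w\<bar> \<le> e * r"
    if vw: "v \<in> F" "w \<in> F" and e: "0 \<le> e" and le: "\<And>x. ennreal \<bar>v x - w x\<bar> \<le> ennreal e * chi x" for v w e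
  proof -
    have "ennreal (v x - w x) \<le> ennreal e * chi x" "ennreal (w x - v x) \<le> ennreal e * chi x" for x
      by (rule order_trans[OF ennreal_leI le[of x]], simp)+
    then have "L (\<lambda>x. v x - w x) \<le> e * r" "L (\<lambda>x. w x - v x) \<le> e * r"
      using Lchi[OF function_space_diff[OF F vw] e] Lchi[OF function_space_diff[OF F vw(2,1)] e]
      by auto
    then show ?thesis
      using linear_functional_on_diff[OF L(1) F vw] linear_functional_on_diff[OF L(1) F vw(2,1)]
      by (simp add: abs_le_iff)
  qed
  have lsc: "lower_semicontinuous chi" using modulus by (simp add: regularity_modulus_def)
  interpret tight_functional L
  proof
    show "completely_regular_space (euclidean :: 'x topology)" by (rule cr)
    show "linear_functional_on bounded_continuous L"
      using L(1) CF by (simp add: linear_functional_on_def)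
    show "0 \<le> L f" if "f \<in> bounded_continuous" "\<And>x. 0 \<le> f x" for f
      using Lnonneg[OF CF[OF that(1)] that(2)] .
    show "L (\<lambda>x. 1) = 1" using L\<Phi>[OF G(2)[of 1]] one by simp
  next
    fix e :: real assume e: "0 < e"
    \<comment> \<open>Outside of the sublevel set at height \<open>c\<close>, functions bounded by
      1 are at most \<open>chi / c\<close>, and \<open>r / c \<le> e\<close>.\<close>
    define c where "c = (r + 1) / e"
    have c: "0 < c" using e r by (simp add: c_def)
    let ?C = "closure (sublevel chi (\<lambda>x. c))"
    have "L f \<le> e" if f: "f \<in> bounded_continuous" "\<And>x. f x \<le> 1" "\<And>x. x \<in> ?C \<Longrightarrow> f x = 0" for f
    proof -
      have "L f \<le> (1 / c) * r"
      proof (rule Lchi[OF CF[OF f(1)]])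
        fix x
        show "ennreal (f x) \<le> ennreal (1 / c) * chi x"
        proof (cases "x \<in> ?C")
          case False
          then have "x \<notin> sublevel chi (\<lambda>x. c)" using closure_subset by blast
          then have "ennreal c \<le> chi x" by (simp add: sublevel_def flip: ereal_le_enn2ereal_iff)
          then have "ennreal (1 / c) * ennreal c \<le> ennreal (1 / c) * chi x"
            by (intro mult_left_mono) auto
          moreover have "ennreal (1 / c) * ennreal c = 1" using c by (simp add: ennreal_mult'[symmetric])
          moreover have "ennreal (f x) \<le> 1" using f(2)[of x] by (simp add: ennreal_le_1)
          ultimately show ?thesis by (metis order_trans)
        qed (simp add: f(3))
      qed (use c in simp)
      also have "\<dots> \<le> e" using e r by (simp add: c_def field_simps)
      finally show ?thesis .
    qed
    then have "\<forall>f\<in>bounded_continuous. (\<forall>x. 0 \<le> f x \<and> f x \<le> 1) \<longrightarrow>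
        (\<forall>x\<in>?C. f x = 0) \<longrightarrow> L f \<le> e" by auto
    moreover have "compact ?C" using modulus G(2) by (simp add: regularity_modulus_def)
    ultimately show "\<exists>C. compact C \<and> (\<forall>f\<in>bounded_continuous. (\<forall>x. 0 \<le> f x \<and> f x \<le> 1) \<longrightarrow>
        (\<forall>x\<in>C. f x = 0) \<longrightarrow> L f \<le> e)" by (intro exI[of _ ?C] conjI)
  qed
  interpret \<mu>: prob_space riesz_measure by (rule prob_space_riesz_measure)
  have chi_le: "(\<integral>\<^sup>+x. chi x \<partial>riesz_measure) \<le> ennreal r"
    by (rule nn_integral_riesz_measure_le[OF lsc _ r]) (use Lchi[OF CF, of _ 1] in auto)
  have [measurable]: "chi \<in> borel_measurable borel" by (rule lower_semicontinuous_measurable[OF lsc])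
  have scaled: "(\<integral>\<^sup>+x. ennreal e * chi x \<partial>riesz_measure) \<le> ennreal (e * r)" if "0 \<le> e" for e
    using mult_left_mono[OF chi_le, of "ennreal e"] that r
    by (simp add: nn_integral_cmult ennreal_mult)
  \<comment> \<open>Approximate \<open>g\<close> by a bounded continuous \<open>h\<close> up to
    \<open>e * chi\<close>: both \<open>L\<close> and the integral change by at most \<open>e *
    r\<close>.\<close>
  have G_integral: "integrable riesz_measure g \<and> (\<integral>x. g x \<partial>riesz_measure) = \<Phi> g" if g: "g \<in> G" for g
  proof -
    have [measurable]: "g \<in> borel_measurable borel" using reg[OF g] by (simp add: chi_regular_def)
    obtain u where u: "u \<in> G" "\<And>x. max (g x) (- g x) \<le> u x" using dir[OF g Gminus[OF g]] by auto
    have gu: "\<bar>g x\<bar> \<le> u x" for x using u(2)[of x] by (simp add: abs_le_iff)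
    have close: "integrable riesz_measure g" "\<bar>(\<integral>x. g x \<partial>riesz_measure) - \<Phi> g\<bar> \<le> 2 * (e * r)"
      if e: "0 < e" for e
    proof -
      have "\<exists>h\<in>bounded_continuous. \<forall>x. ennreal \<bar>g x - h x\<bar> \<le> ennreal e * chi x"
        by (rule regular_approximation[OF cr G dir modulus reg[OF g] u(1) gu e])
      then obtain h where h: "h \<in> bounded_continuous"
        "\<And>x. ennreal \<bar>g x - h x\<bar> \<le> ennreal e * chi x" by blast
      have hi: "integrable riesz_measure h" by (rule integrable_riesz_measure[OF h(1)])
      have [measurable]: "h \<in> borel_measurable borel"
        using h(1) by (intro borel_measurable_continuous_onI bounded_continuous_continuous)
      have le: "(\<integral>\<^sup>+x. ennreal \<bar>g x - h x\<bar> \<partial>riesz_measure) \<le> ennreal (e * r)"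
        using nn_integral_mono[of riesz_measure, OF h(2)] scaled[of e] e by (meson less_imp_le order_trans)
      have di: "integrable riesz_measure (\<lambda>x. g x - h x)"
      proof (rule integrableI_bounded)
        show "(\<integral>\<^sup>+x. ennreal (norm (g x - h x)) \<partial>riesz_measure) < \<infinity>"
          using le by (simp add: le_less_trans[OF _ ennreal_less_top])
      qed measurable
      show gi: "integrable riesz_measure g" using Bochner_Integration.integrable_add[OF di hi] by simp
      have er: "0 \<le> e * r" using e r by simp
      have "(\<integral>x. \<bar>g x - h x\<bar> \<partial>riesz_measure) \<le> e * r"
        by (rule integral_le_of_nn_integral_le[OF _ le er]) (use di in simp)
      then have "\<bar>(\<integral>x. g x \<partial>riesz_measure) - L h\<bar> \<le> e * r"
        using integral_abs_bound[of riesz_measure "\<lambda>x. g x - h x"] gi hi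
        by (simp add: integral_riesz_measure[OF h(1)])
      moreover have "\<bar>L g - L h\<bar> \<le> e * r"
        by (rule Lapprox[OF GF[OF g] CF[OF h(1)] _ h(2)]) (use e in simp)
      ultimately show "\<bar>(\<integral>x. g x \<partial>riesz_measure) - \<Phi> g\<bar> \<le> 2 * (e * r)"
        using L\<Phi>[OF g] by linarith
    qed
    have "\<bar>(\<integral>x. g x \<partial>riesz_measure) - \<Phi> g\<bar> \<le> 0"
    proof (rule field_le_epsilon)
      fix d :: real assume d: "0 < d"
      have "2 * (d / (2 * (r + 1)) * r) \<le> d" using d r by (simp add: field_simps)
      then show "\<bar>(\<integral>x. g x \<partial>riesz_measure) - \<Phi> g\<bar> \<le> 0 + d"
        using close(2)[of "d / (2 * (r + 1))"] d r by simp
    qed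
    then show ?thesis using close(1)[of 1] by simp
  qed
  have "distr riesz_measure borel \<theta> = riesz_measure" if \<theta>: "\<theta> \<in> \<Theta>" for \<theta>
  proof -
    obtain \<eta> where \<eta>: "\<eta> \<in> \<Theta>" "\<theta> \<circ> \<eta> = id" using inverse[OF \<theta>] by blast
    have "\<eta> \<circ> \<theta> = id" using comm[OF \<theta> \<eta>(1)] \<eta>(2) by simp
    with \<eta>(2) have "\<theta> (\<eta> x) = x" "\<eta> (\<theta> x) = x" for x by (auto simp: fun_eq_iff)
    then show ?thesis
      using L(2) \<theta> CF
      by (intro distr_riesz_measure[OF cont[OF \<theta>] cont[OF \<eta>(1)]]) (auto simp: invariant_functional_def)
  qed
  then have "invariant_realisation \<Theta> G chi \<Phi> r riesz_measure"
    using G_integral chi_le prob_space_riesz_measure by (simp add: invariant_realisation_def)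
  then show ?thesis ..
qed

text \<open>
  Here the multiples of the modulus are an invariant cone, and consistency with \<open>\<Phi>\<close> is the
  hypothesis on minorants up to scaling. The empty set of transformations is allowed, and then
  every modulus is invariant; this gives realisations, not necessarily stationary, for an arbitrary
  modulus.
\<close>

theorem realisation_with_invariant_modulus:
  fixes \<Theta> :: "('x::topological_space \<Rightarrow> 'x) set"
  assumes cr: "completely_regular_space (euclidean :: 'x topology)"
    and comm: "\<And>\<theta> \<eta>. \<theta> \<in> \<Theta> \<Longrightarrow> \<eta> \<in> \<Theta> \<Longrightarrow> \<theta> \<circ> \<eta> = \<eta> \<circ> \<theta>"
    and cont: "\<And>\<theta>. \<theta> \<in> \<Theta> \<Longrightarrow> continuous_on UNIV \<theta>"
    and inverse: "\<And>\<theta>. \<theta> \<in> \<Theta> \<Longrightarrow> \<exists>\<eta>\<in>\<Theta>. \<theta> \<circ> \<eta> = id"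
    and G: "function_space G" "\<And>c. (\<lambda>x. c) \<in> G"
    and dir: "\<And>g1 g2. g1 \<in> G \<Longrightarrow> g2 \<in> G \<Longrightarrow> \<exists>g\<in>G. \<forall>x. max (g1 x) (g2 x) \<le> g x"
    and modulus: "regularity_modulus G chi"
    and reg: "\<And>g. g \<in> G \<Longrightarrow> chi_regular G chi g"
    and lin: "linear_functional_on G \<Phi>" and inv: "invariant_functional \<Theta> G \<Phi>"
    and one: "\<Phi> (\<lambda>x. 1) = 1" and r: "0 \<le> r"
    and chi_inv: "invariant_function \<Theta> chi"
    and minorant: "\<And>g. g \<in> G \<Longrightarrow> (\<And>x. ennreal (g x) \<le> chi x) \<Longrightarrow> \<Phi> g \<le> r"
  shows "\<exists>\<mu>. invariant_realisation \<Theta> G chi \<Phi> r \<mu>"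
proof -
  let ?cost = "\<lambda>a \<psi>. \<exists>c\<ge>0. \<psi> = (\<lambda>x. ennreal c * chi x) \<and> a = c * r"
  have bound: "\<Phi> g \<le> c * r" if g: "g \<in> G" and c: "0 \<le> c" and le: "\<And>x. ennreal (g x) \<le> ennreal c * chi x" for g c
  proof -
    \<comment> \<open>Taking \<open>d = 1 / c\<close>, or \<open>d\<close> arbitrarily large if \<open>c = 0\<close>, turns this into the claim.\<close>
    have scaled: "d * \<Phi> g \<le> r" if d: "0 \<le> d" "d * c \<le> 1" for d
    proof -
      have "\<Phi> (\<lambda>x. d * g x) \<le> r"
      proof (rule minorant[OF function_space_scale[OF G(1) g]])
        fix x
        have "ennreal (d * g x) = ennreal d * ennreal (g x)" using d(1) by (rule ennreal_mult')
        also have "\<dots> \<le> ennreal d * (ennreal c * chi x)" by (intro mult_left_mono le) simp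
        also have "\<dots> = ennreal (d * c) * chi x" using d(1) by (simp add: ennreal_mult' mult.assoc)
        also have "\<dots> \<le> 1 * chi x" using d(2) by (intro mult_right_mono) (auto simp: ennreal_le_1)
        finally show "ennreal (d * g x) \<le> chi x" by simp
      qed
      then show ?thesis by (simp add: linear_functional_on_scale[OF lin g])
    qed
    show ?thesis
    proof (cases "c = 0")
      case False
      then show ?thesis using scaled[of "1 / c"] c by (simp add: field_simps)
    next
      case True
      have "\<Phi> g \<le> 0"
      proof (rule ccontr)
        assume "\<not> \<Phi> g \<le> 0"
        then show False using scaled[of "(r + 1) / \<Phi> g"] True r by simp
      qed
      then show ?thesis using True by simp
    qed
  qed
  show ?thesis
  proof (rule realisation_of_dominated_functional[OF cr comm cont inverse G dir modulus reg lin inv one r,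
        where cost = ?cost])
    show "?cost (a + b) (\<lambda>x. \<psi> x + \<phi> x)" if "?cost a \<psi>" "?cost b \<phi>" for a \<psi> b \<phi>
    proof -
      from that obtain c d where "0 \<le> c" "0 \<le> d" "\<psi> = (\<lambda>x. ennreal c * chi x)" "a = c * r"
        "\<phi> = (\<lambda>x. ennreal d * chi x)" "b = d * r" by blast
      then show ?thesis by (intro exI[of _ "c + d"]) (simp add: distrib_right)
    qed
    show "?cost (d * a) (\<lambda>x. ennreal d * \<psi> x)" if d: "0 \<le> d" and "?cost a \<psi>" for d a \<psi>
    proof -
      from that obtain c where "0 \<le> c" "\<psi> = (\<lambda>x. ennreal c * chi x)" "a = c * r" by blast
      then show ?thesis
        using d by (intro exI[of _ "d * c"]) (simp add: ennreal_mult mult.assoc)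
    qed
    show "?cost a (\<psi> \<circ> \<theta>)" if \<theta>: "\<theta> \<in> \<Theta>" and "?cost a \<psi>" for \<theta> a \<psi>
    proof -
      from that obtain c where "0 \<le> c" "\<psi> = (\<lambda>x. ennreal c * chi x)" "a = c * r" by blast
      moreover have "chi (\<theta> x) = chi x" for x
        using chi_inv \<theta> unfolding invariant_function_def by (metis comp_apply)
      ultimately show ?thesis by (intro exI[of _ c]) (simp add: o_def)
    qed
    show "?cost r chi" by (rule exI[of _ 1]) simp
    show "\<Phi> g \<le> a" if "g \<in> G" "?cost a \<psi>" "\<And>x. ennreal (g x) \<le> \<psi> x" for g a \<psi>
      using that bound by blast
  qed
qed

section \<open>Stationary realisations\<close>

text \<open>
  Monotone convergence along the approximating sequence. Its members may be negative, and adding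
  the absolute value of the first one makes all of them nonnegative.
\<close>

lemma nn_integral_approximated_le:
  fixes chi :: "'x::topological_space \<Rightarrow> ennreal"
  assumes sets: "sets \<mu> = sets (borel :: 'x measure)"
    and meas: "\<theta> \<in> measurable borel (borel :: 'x measure)" "chi \<in> borel_measurable borel"
      "\<And>n. gs n \<in> borel_measurable borel"
    and inc: "\<And>x. incseq (\<lambda>n. gs n x)"
    and lim: "\<And>x. (\<lambda>n. ereal (gs n x)) \<longlonglongrightarrow> enn2ereal (chi x)"
    and int: "\<And>n. integrable \<mu> (\<lambda>x. gs n (\<theta> x))" "\<And>n. (\<integral>x. gs n (\<theta> x) \<partial>\<mu>) \<le> r" and r: "0 \<le> r"
  shows "(\<integral>\<^sup>+x. chi (\<theta> x) \<partial>\<mu>) \<le> ennreal r"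
proof -
  note [measurable] = meas
  note [measurable_cong] = sets
  define w where "w n x = gs n (\<theta> x) + \<bar>gs 0 (\<theta> x)\<bar>" for n x
  define I where "I = (\<integral>x. \<bar>gs 0 (\<theta> x)\<bar> \<partial>\<mu>)"
  have I: "0 \<le> I" by (simp add: I_def)
  have w_nonneg: "0 \<le> w n x" for n x
    using incseqD[OF inc[of "\<theta> x"], of 0 n] by (simp add: w_def)
  have wi: "integrable \<mu> (w n)" for n unfolding w_def using int(1) by simp
  have w_le: "(\<integral>\<^sup>+x. ennreal (w n x) \<partial>\<mu>) \<le> ennreal (r + I)" for n
  proof -
    have "(\<integral>x. w n x \<partial>\<mu>) = (\<integral>x. gs n (\<theta> x) \<partial>\<mu>) + I"
      unfolding w_def I_def using int(1) by simp
    then have "(\<integral>x. w n x \<partial>\<mu>) \<le> r + I" using int(2)[of n] by simp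
    then show ?thesis
      using nn_integral_eq_integral[OF wi] w_nonneg by (simp add: ennreal_leI)
  qed
  have "(\<lambda>n. ennreal (w n x)) \<longlonglongrightarrow> chi (\<theta> x) + ennreal \<bar>gs 0 (\<theta> x)\<bar>" for x
  proof -
    have "(\<lambda>n. ereal (gs n (\<theta> x)) + ereal \<bar>gs 0 (\<theta> x)\<bar>)
        \<longlonglongrightarrow> enn2ereal (chi (\<theta> x)) + ereal \<bar>gs 0 (\<theta> x)\<bar>"
      by (intro tendsto_add_ereal_general lim tendsto_const) auto
    then have "(\<lambda>n. e2ennreal (ereal (w n x)))
        \<longlonglongrightarrow> e2ennreal (enn2ereal (chi (\<theta> x)) + ereal \<bar>gs 0 (\<theta> x)\<bar>)"
      using continuous_on_tendsto_compose[OF continuous_on_e2ennreal[of UNIV]]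
      by (fastforce simp: w_def)
    moreover have "enn2ereal (chi (\<theta> x)) + ereal \<bar>gs 0 (\<theta> x)\<bar>
        = enn2ereal (chi (\<theta> x) + ennreal \<bar>gs 0 (\<theta> x)\<bar>)"
      by (simp add: plus_ennreal.rep_eq enn2ereal_ennreal)
    ultimately show ?thesis by (simp add: e2ennreal_ereal)
  qed
  then have "(\<lambda>n. \<integral>\<^sup>+x. ennreal (w n x) \<partial>\<mu>) \<longlonglongrightarrow> (\<integral>\<^sup>+x. chi (\<theta> x) + ennreal \<bar>gs 0 (\<theta> x)\<bar> \<partial>\<mu>)"
    using incseqD[OF inc]
    by (intro nn_integral_LIMSEQ) (auto simp: w_def incseq_def le_fun_def intro!: ennreal_leI)
  then have "(\<integral>\<^sup>+x. chi (\<theta> x) + ennreal \<bar>gs 0 (\<theta> x)\<bar> \<partial>\<mu>) \<le> ennreal (r + I)"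
    by (rule LIMSEQ_le_const2) (use w_le in blast)
  moreover have "(\<integral>\<^sup>+x. ennreal \<bar>gs 0 (\<theta> x)\<bar> \<partial>\<mu>) = ennreal I"
    unfolding I_def using int(1) by (intro nn_integral_eq_integral) auto
  ultimately have "(\<integral>\<^sup>+x. chi (\<theta> x) \<partial>\<mu>) + ennreal I \<le> ennreal r + ennreal I"
    using r I by (simp add: nn_integral_add)
  then show ?thesis by (simp add: add.commute[of _ "ennreal I"] ennreal_add_left_cancel_le)
qed

text \<open>
  All functions are extensional on the universal set, so composition, identity and inverses of
  \<open>BijGroup UNIV\<close> are the usual ones.
\<close>

lemma abelian_transformation_groupD:
  assumes "abelian_transformation_group \<Theta>"
  shows "\<theta> \<in> \<Theta> \<Longrightarrow> continuous_on UNIV \<theta>"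
    and "id \<in> \<Theta>"
    and "\<theta> \<in> \<Theta> \<Longrightarrow> \<eta> \<in> \<Theta> \<Longrightarrow> \<theta> \<circ> \<eta> \<in> \<Theta>"
    and "\<theta> \<in> \<Theta> \<Longrightarrow> \<eta> \<in> \<Theta> \<Longrightarrow> \<theta> \<circ> \<eta> = \<eta> \<circ> \<theta>"
    and "\<theta> \<in> \<Theta> \<Longrightarrow> \<exists>\<eta>\<in>\<Theta>. \<theta> \<circ> \<eta> = id"
proof -
  have sub: "subgroup \<Theta> (BijGroup UNIV)"
    and comm: "comm_group ((BijGroup UNIV)\<lparr>carrier := \<Theta>\<rparr>)"
    and cont: "\<forall>\<theta>\<in>\<Theta>. continuous_on UNIV \<theta>"
    using assms by (auto simp: abelian_transformation_group_def)
  have bij: "\<theta> \<in> Bij UNIV" if "\<theta> \<in> \<Theta>" for \<theta>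
    using subgroup.mem_carrier[OF sub that] by (simp add: BijGroup_def)
  have mult: "\<theta> \<otimes>\<^bsub>BijGroup UNIV\<^esub> \<eta> = \<theta> \<circ> \<eta>" if "\<theta> \<in> \<Theta>" "\<eta> \<in> \<Theta>" for \<theta> \<eta>
    using bij that by (auto simp: BijGroup_def compose_def fun_eq_iff)
  have one: "\<one>\<^bsub>BijGroup UNIV\<^esub> = (id :: 'a \<Rightarrow> 'a)" by (auto simp: BijGroup_def fun_eq_iff)
  show "continuous_on UNIV \<theta>" if "\<theta> \<in> \<Theta>" using cont that by blast
  show "id \<in> \<Theta>" using subgroup.one_closed[OF sub] one by simp
  show "\<theta> \<circ> \<eta> \<in> \<Theta>" if "\<theta> \<in> \<Theta>" "\<eta> \<in> \<Theta>"
    using subgroup.m_closed[OF sub that] mult[OF that] by simp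
  show "\<theta> \<circ> \<eta> = \<eta> \<circ> \<theta>" if "\<theta> \<in> \<Theta>" "\<eta> \<in> \<Theta>"
  proof -
    interpret C: comm_group "(BijGroup UNIV)\<lparr>carrier := \<Theta>\<rparr>" by (rule comm)
    show ?thesis using C.m_comm[of \<theta> \<eta>] that mult[OF that] mult[OF that(2,1)] by simp
  qed
  show "\<exists>\<eta>\<in>\<Theta>. \<theta> \<circ> \<eta> = id" if "\<theta> \<in> \<Theta>"
  proof -
    interpret group "BijGroup (UNIV :: 'a set)" by (rule group_BijGroup)
    have "inv\<^bsub>BijGroup UNIV\<^esub> \<theta> \<in> \<Theta>" by (rule subgroup.m_inv_closed[OF sub that])
    moreover have "\<theta> \<otimes>\<^bsub>BijGroup UNIV\<^esub> inv\<^bsub>BijGroup UNIV\<^esub> \<theta> = \<one>\<^bsub>BijGroup UNIV\<^esub>"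
      using subgroup.mem_carrier[OF sub that] by (rule r_inv)
    ultimately show ?thesis using mult[OF that] one by metis
  qed
qed

lemma minorant_sup_le_iff:
  "minorant_sup G chi \<Phi> \<le> ereal r \<longleftrightarrow> (\<forall>g\<in>G. (\<forall>x. ennreal (g x) \<le> chi x) \<longrightarrow> \<Phi> g \<le> r)"
  by (auto simp: minorant_sup_def SUP_le_iff ereal_le_enn2ereal_iff)

lemma realises_imp_minorant_sup_le:
  assumes "realises G chi \<Phi> r M \<xi>" "0 \<le> r"
  shows "minorant_sup G chi \<Phi> \<le> ereal r"
  unfolding minorant_sup_le_iff
proof (intro ballI impI)
  fix g assume g: "g \<in> G" and le: "\<forall>x. ennreal (g x) \<le> chi x"
  have "(\<integral>\<^sup>+\<omega>. ennreal (g (\<xi> \<omega>)) \<partial>M) \<le> (\<integral>\<^sup>+\<omega>. chi (\<xi> \<omega>) \<partial>M)"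
    using le by (intro nn_integral_mono) auto
  then have "(\<integral>\<^sup>+\<omega>. ennreal (g (\<xi> \<omega>)) \<partial>M) \<le> ennreal r"
    using assms(1) by (auto simp: realises_def)
  then show "\<Phi> g \<le> r"
    using integral_le_of_nn_integral_le[of M "\<lambda>\<omega>. g (\<xi> \<omega>)" r] assms g by (auto simp: realises_def)
qed

(* HOL cannot quantify existentially over the type carrying the sample space. The equivalence
   takes sample spaces on the type of the state space; the second conjunct gives the necessity
   for random elements defined on a sample space of any type. *)
theorem theorem2p10:
  fixes \<Theta> :: "('x::topological_space \<Rightarrow> 'x) set"
    and G :: "('x \<Rightarrow> real) set"
    and chi :: "'x \<Rightarrow> ennreal"
    and \<Phi> :: "('x \<Rightarrow> real) \<Rightarrow> real"
    and r :: real
  assumes "completely_regular_space (euclidean :: 'x topology)"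
    and "abelian_transformation_group \<Theta>"
    and "function_space G"
    and "invariant_space \<Theta> G"
    and "\<forall>c. (\<lambda>x. c) \<in> G"
    and "\<forall>g1\<in>G. \<forall>g2\<in>G. \<exists>g\<in>G. \<forall>x. max (g1 x) (g2 x) \<le> g x"
    and "regularity_modulus G chi"
    and "\<forall>g\<in>G. chi_regular G chi g"
    and "((\<forall>g\<in>G. continuous_on UNIV g) \<and> approximated_from_below G chi)
         \<or> invariant_function \<Theta> chi"
    and "linear_functional_on G \<Phi>"
    and "invariant_functional \<Theta> G \<Phi>"
    and "\<Phi> (\<lambda>x. 1) = 1"
    and "0 \<le> r"
  shows "((\<exists>(M :: 'x measure) \<xi>. stationary_element \<Theta> M \<xi> \<and> realises G chi \<Phi> r M \<xi>)
            \<longleftrightarrow> minorant_sup G chi \<Phi> \<le> ereal r)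
       \<and> (\<forall>(N :: 'w measure) \<zeta>. stationary_element \<Theta> N \<zeta> \<and> realises G chi \<Phi> r N \<zeta>
            \<longrightarrow> minorant_sup G chi \<Phi> \<le> ereal r)"
proof -
  note group = abelian_transformation_groupD[OF assms(2)]
  have const: "\<And>c. (\<lambda>x. c) \<in> G" using assms(5) by blast
  have dir: "\<And>g1 g2. g1 \<in> G \<Longrightarrow> g2 \<in> G \<Longrightarrow> \<exists>g\<in>G. \<forall>x. max (g1 x) (g2 x) \<le> g x"
    using assms(6) by blast
  have reg: "\<And>g. g \<in> G \<Longrightarrow> chi_regular G chi g" using assms(8) by blast
  have "\<exists>(M :: 'x measure) \<xi>. stationary_element \<Theta> M \<xi> \<and> realises G chi \<Phi> r M \<xi>"
    if "minorant_sup G chi \<Phi> \<le> ereal r"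
  proof -
    have minorant: "\<Phi> g \<le> r" if "g \<in> G" "\<And>x. ennreal (g x) \<le> chi x" for g
      using \<open>minorant_sup G chi \<Phi> \<le> ereal r\<close> that by (auto simp: minorant_sup_le_iff)
    have "\<exists>\<mu>. invariant_realisation \<Theta> G chi \<Phi> r \<mu>"
      using assms(9)
    proof
      assume chi_inv: "invariant_function \<Theta> chi"
      show ?thesis
        by (rule realisation_with_invariant_modulus[OF assms(1) group(4,1,5) assms(3) const dir
              assms(7) reg assms(10,11,12,13) chi_inv minorant])
    next
      assume "(\<forall>g\<in>G. continuous_on UNIV g) \<and> approximated_from_below G chi"
      then obtain gs where gs: "\<And>n. gs n \<in> G" "\<And>x. incseq (\<lambda>n. gs n x)"
        "\<And>x. (\<lambda>n. ereal (gs n x)) \<longlonglongrightarrow> enn2ereal (chi x)"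
        by (auto simp: approximated_from_below_def)
      have invG: "g \<circ> \<theta> \<in> G" "\<Phi> (g \<circ> \<theta>) = \<Phi> g" if "\<theta> \<in> \<Theta>" "g \<in> G" for \<theta> g
        using assms(11) that by (auto simp: invariant_functional_def)
      have gs_le: "\<Phi> (gs n) \<le> r" for n
      proof (rule minorant[OF gs(1)])
        have "ereal (gs n x) \<le> enn2ereal (chi x)" for x
          by (rule incseq_le[OF _ gs(3)]) (use gs(2) in \<open>auto simp: incseq_def\<close>)
        then show "ennreal (gs n x) \<le> chi x" for x by (simp add: ereal_le_enn2ereal_iff)
      qed
      \<comment> \<open>A realisation without the requirement of stationarity; it serves to define
        the cost.\<close>
      have "\<exists>\<mu>. invariant_realisation {} G chi \<Phi> r \<mu>"
        by (rule realisation_with_invariant_modulus[OF assms(1) _ _ _ assms(3) const dir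
            assms(7) reg assms(10) _ assms(12,13) _ minorant])
          (simp_all add: invariant_functional_def invariant_function_def)
      then obtain \<mu> :: "'x measure" where \<mu>: "prob_space \<mu>" "sets \<mu> = sets borel"
        "\<And>g. g \<in> G \<Longrightarrow> integrable \<mu> g" "\<And>g. g \<in> G \<Longrightarrow> (\<integral>x. g x \<partial>\<mu>) = \<Phi> g"
        by (auto simp: invariant_realisation_def)
      note [measurable_cong] = \<mu>(2)
      have chi_meas [measurable]: "chi \<in> borel_measurable borel"
        using assms(7) by (intro lower_semicontinuous_measurable) (simp add: regularity_modulus_def)
      have \<theta>_meas: "\<theta> \<in> measurable borel borel" if "\<theta> \<in> \<Theta>" for \<theta>
        using group(1)[OF that] by (rule borel_measurable_continuous_onI)
      \<comment> \<open>This cost is invariant by definition. It charges \<open>chi\<close> with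
        at most \<open>r\<close>, because the integral of every translate of \<open>chi\<close> is
        the limit of the invariant values \<open>\<Phi> (gs n)\<close>.\<close>
      let ?cost = "\<lambda>a \<psi>. \<psi> \<in> borel_measurable borel \<and> 0 \<le> a \<and>
        (\<forall>\<theta>\<in>\<Theta>. (\<integral>\<^sup>+x. \<psi> (\<theta> x) \<partial>\<mu>) \<le> ennreal a)"
      show ?thesis
      proof (rule realisation_of_dominated_functional[OF assms(1) group(4,1,5) assms(3) const dir
              assms(7) reg assms(10,11,12,13), where cost = ?cost])
        fix a b :: real and \<psi> \<phi> :: "'x \<Rightarrow> ennreal" assume "?cost a \<psi>" "?cost b \<phi>"
        then have [measurable]: "\<psi> \<in> borel_measurable borel" "\<phi> \<in> borel_measurable borel"
          and a: "0 \<le> a" "\<And>\<theta>. \<theta> \<in> \<Theta> \<Longrightarrow> (\<integral>\<^sup>+x. \<psi> (\<theta> x) \<partial>\<mu>) \<le> ennreal a"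
          and b: "0 \<le> b" "\<And>\<theta>. \<theta> \<in> \<Theta> \<Longrightarrow> (\<integral>\<^sup>+x. \<phi> (\<theta> x) \<partial>\<mu>) \<le> ennreal b" by auto
        have "(\<integral>\<^sup>+x. \<psi> (\<theta> x) + \<phi> (\<theta> x) \<partial>\<mu>) \<le> ennreal (a + b)" if \<theta>: "\<theta> \<in> \<Theta>" for \<theta>
        proof -
          note [measurable] = \<theta>_meas[OF \<theta>]
          show ?thesis using add_mono[OF a(2)[OF \<theta>] b(2)[OF \<theta>]] a(1) b(1)
            by (simp add: nn_integral_add)
        qed
        then show "?cost (a + b) (\<lambda>x. \<psi> x + \<phi> x)" using a(1) b(1) by auto
      next
        fix c a :: real and \<psi> :: "'x \<Rightarrow> ennreal" assume c: "0 \<le> c" and "?cost a \<psi>"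
        then have [measurable]: "\<psi> \<in> borel_measurable borel"
          and a: "0 \<le> a" "\<And>\<theta>. \<theta> \<in> \<Theta> \<Longrightarrow> (\<integral>\<^sup>+x. \<psi> (\<theta> x) \<partial>\<mu>) \<le> ennreal a" by auto
        have "(\<integral>\<^sup>+x. ennreal c * \<psi> (\<theta> x) \<partial>\<mu>) \<le> ennreal (c * a)" if \<theta>: "\<theta> \<in> \<Theta>" for \<theta>
        proof -
          note [measurable] = \<theta>_meas[OF \<theta>]
          show ?thesis using mult_left_mono[OF a(2)[OF \<theta>], of "ennreal c"] a(1) c
            by (simp add: nn_integral_cmult ennreal_mult)
        qed
        then show "?cost (c * a) (\<lambda>x. ennreal c * \<psi> x)" using a(1) c by auto
      next
        fix \<theta> a and \<psi> :: "'x \<Rightarrow> ennreal" assume \<theta>: "\<theta> \<in> \<Theta>" and *: "?cost a \<psi>"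
        have "\<psi> \<circ> \<theta> \<in> borel_measurable borel"
          using \<theta>_meas[OF \<theta>] * by (intro measurable_comp[of \<theta> borel borel]) auto
        moreover have "(\<integral>\<^sup>+x. (\<psi> \<circ> \<theta>) (\<eta> x) \<partial>\<mu>) \<le> ennreal a" if "\<eta> \<in> \<Theta>" for \<eta>
          using * group(3)[OF \<theta> that] by fastforce
        ultimately show "?cost a (\<psi> \<circ> \<theta>)" using * by blast
      next
        have "(\<integral>\<^sup>+x. chi (\<theta> x) \<partial>\<mu>) \<le> ennreal r" if \<theta>: "\<theta> \<in> \<Theta>" for \<theta>
        proof (rule nn_integral_approximated_le[OF \<mu>(2) \<theta>_meas[OF \<theta>] chi_meas _ gs(2,3) _ _ assms(13)])
          show "gs n \<in> borel_measurable borel" for n using reg[OF gs(1)] by (simp add: chi_regular_def)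
          show "integrable \<mu> (\<lambda>x. gs n (\<theta> x))" for n
            using \<mu>(3)[OF invG(1)[OF \<theta> gs(1)]] by (simp add: o_def)
          show "(\<integral>x. gs n (\<theta> x) \<partial>\<mu>) \<le> r" for n
            using \<mu>(4)[OF invG(1)[OF \<theta> gs(1)]] invG(2)[OF \<theta> gs(1)] gs_le[of n] by (simp add: o_def)
        qed
        then show "?cost r chi" using assms(13) by auto
      next
        fix g a and \<psi> :: "'x \<Rightarrow> ennreal"
        assume g: "g \<in> G" and *: "?cost a \<psi>" and le: "\<And>x. ennreal (g x) \<le> \<psi> x"
        have "(\<integral>\<^sup>+x. ennreal (g x) \<partial>\<mu>) \<le> (\<integral>\<^sup>+x. \<psi> (id x) \<partial>\<mu>)"
          using le by (intro nn_integral_mono) simp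
        also have "\<dots> \<le> ennreal a" using * group(2) by blast
        finally show "\<Phi> g \<le> a"
          using integral_le_of_nn_integral_le[OF \<mu>(3)[OF g]] \<mu>(4)[OF g] * by simp
      qed
    qed
    then obtain \<mu> :: "'x measure" where \<mu>: "prob_space \<mu>" "sets \<mu> = sets borel"
      "\<forall>\<theta>\<in>\<Theta>. distr \<mu> borel \<theta> = \<mu>" "\<forall>g\<in>G. integrable \<mu> g" "\<forall>g\<in>G. (\<integral>x. g x \<partial>\<mu>) = \<Phi> g"
      "(\<integral>\<^sup>+x. chi x \<partial>\<mu>) \<le> ennreal r" by (auto simp: invariant_realisation_def)
    have "distr \<mu> borel (\<lambda>x. x) = \<mu>" using distr_id2[OF \<mu>(2)[symmetric]] by simp
    then have "stationary_element \<Theta> \<mu> (\<lambda>x. x)"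
      using \<mu>(1,3) measurable_ident_sets[OF \<mu>(2)] by (simp add: stationary_element_def)
    moreover have "realises G chi \<Phi> r \<mu> (\<lambda>x. x)" using \<mu>(4-6) by (simp add: realises_def)
    ultimately show ?thesis by blast
  qed
  moreover have "minorant_sup G chi \<Phi> \<le> ereal r"
    if "realises G chi \<Phi> r M \<xi>" for M :: "'x measure" and \<xi>
    using realises_imp_minorant_sup_le[OF that assms(13)] .
  moreover have "minorant_sup G chi \<Phi> \<le> ereal r"
    if "realises G chi \<Phi> r N \<zeta>" for N :: "'w measure" and \<zeta>
    using realises_imp_minorant_sup_le[OF that assms(13)] .
  ultimately show ?thesis by blast
qed

end
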